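(* Fix positive weights $w=(w_1,\dots,w_N)$, with associated clusters $C_1,\dots,C_K$ and drift rates $V_1,\dots,V_K$ from the hierarchical minimax decomposition. The random walk $\xi(t)$ under the JLW policy with weights $w$ eventually displays the hierarchical minimax structure: for all small enough $\varepsilon>0$ and any finite initial configuration $\xi(0)=x_0\in\mathbb{Z}^N$ there exists an almost surely finite random time $t(\varepsilon)$ such that for each cluster $C_k$, $k=1,\dots,K$, and for any $t>t(\varepsilon)$, $$\left|\frac{w_j\xi_j(t)}{t}-V_k\right|<t^{-\varepsilon}\qquad\text{for each } j\in C_k.$$
   Context: Model. $C_0=\{1,\dots,N\}$ is a finite set of stations; station $j$ has service rate $\mu_j>0$. There is a finite collection of non-empty sets (neighbourhoods) $S_i\subseteq C_0$ with arrival rates $\lambda_i\ge 0$; $\mathcal{N}(C_0)$ denotes the collection of neighbourhoods with $\lambda_i>0$, and one writes $i\in\mathcal{N}(C_0)$ for $S_i\in\mathcal{N}(C_0)$. The bipartite graph with nodes $\mathcal{N}(C_0)\cup C_0$ and edges $\{(S_i,j):j\in S_i\}$ is assumed connected. JLW policy and random walk. The JLW (join the least weighted queue) policy with positive weights $w$ routes an arrival at $S_i$ in state $x$ to station $j$ with probability $\pi(x,i)_j=1/|\mathcal{B}_i(x)|$ if $j\in\mathcal{B}_i(x)$ and $0$ otherwise, where $\mathcal{B}_i(x)=\{j\in S_i: w_jx_j=\min_{l\in S_i}w_lx_l\}$. Under this policy $\xi(t)$ is the continuous-time Markov chain on $\mathbb{Z}^N$ (no reflection at $0$) with jumps $x\mapsto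 x+e_j$ at rate $\sum_{i\in\mathcal{N}(C_0):\,j\in S_i}\lambda_i\pi(x,i)_j$ and $x\mapsto x-e_j$ at rate $\mu_j$, for every $x\in\mathbb{Z}^N$ and $j\in C_0$, where $e_j$ is the $j$-th unit vector. Drifts and clusters. A static policy $\pi$ assigns to each $i\in\mathcal{N}(C_0)$ a probability vector $\pi(i)=(\pi(i)_j)_{j\in C_0}$ with $\pi(i)_j=0$ for $j\notin S_i$; $\Pi_{\mathrm{stat}}$ is the set of static policies, and $V(j;\pi)=\sum_{i\in\mathcal{N}(C_0)}\lambda_i\pi(i)_j-\mu_j$. The hierarchical minimax decomposition for weights $w$ is defined recursively: $\Pi_0=\Pi_{\mathrm{stat}}$, $D_1=C_0$; for $k\ge1$ with $D_k\ne\emptyset$, $V_k=\min_{\pi\in\Pi_{k-1}}\max_{j\in D_k}w_jV(j;\pi)$; $C_k\subseteq D_k$ is the (unique) set of minimal cardinality among the sets $\{j\in D_k:w_jV(j;\pi)=V_k\}$, with $\pi$ ranging over the policies in $\Pi_{k-1}$ attaining this minimum; $\Pi_k=\{\pi\in\Pi_{k-1}:\max_{j\in C_k}w_jV(j;\pi)=V_k\}$; $D_{k+1}=D_k\setminus C_k$. The procedure stops at the stage $K\le N$ with $D_{K+1}=\emptyset$, so $C_1,\dots,C_K$ partition $C_0$. *)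

theory Defs
  imports "HOL-Probability.Probability"
begin

subsection \<open>The network\<close>

text \<open>
  Stations are the elements of a finite type \<open>'n\<close>. The neighbourhoods form a family
  \<open>S i\<close>, for \<open>i\<close> in a finite index set \<open>I\<close>, with arrival rates \<open>lam i\<close>. In the definitions
  below \<open>A\<close> stands for the set \<open>active_nbhds I lam\<close>, and a neighbourhood is represented
  by its index.
\<close>

definition active_nbhds :: "'i set \<Rightarrow> ('i \<Rightarrow> real) \<Rightarrow> 'i set" where
  "active_nbhds I lam = {i \<in> I. lam i > 0}"

definition membership_edges :: "'i set \<Rightarrow> ('i \<Rightarrow> 'n set) \<Rightarrow> ('i + 'n) rel" where
  "membership_edges A S = {(Inl i, Inr j) | i j. i \<in> A \<and> j \<in> S i}"

definition connected_network :: "'i set \<Rightarrow> ('i \<Rightarrow> 'n set) \<Rightarrow> bool" where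
  "connected_network A S \<longleftrightarrow>
     (\<forall>u \<in> A <+> UNIV. \<forall>v \<in> A <+> UNIV.
        (u, v) \<in> (membership_edges A S \<union> (membership_edges A S)\<inverse>)\<^sup>*)"

subsection \<open>Hierarchical minimax decomposition\<close>

definition static_policies :: "'i set \<Rightarrow> ('i \<Rightarrow> 'n::finite set) \<Rightarrow> ('i \<Rightarrow> 'n \<Rightarrow> real) set" where
  "static_policies A S =
     (\<Pi>\<^sub>E i\<in>A. {p. (\<forall>j. 0 \<le> p j) \<and> (\<Sum>j\<in>UNIV. p j) = 1 \<and> (\<forall>j. j \<notin> S i \<longrightarrow> p j = 0)})"

definition drift :: "'i set \<Rightarrow> ('i \<Rightarrow> real) \<Rightarrow> ('n \<Rightarrow> real) \<Rightarrow> ('i \<Rightarrow> 'n \<Rightarrow> real) \<Rightarrow> 'n \<Rightarrow> real" where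
  "drift A lam mu \<pi> j = (\<Sum>i\<in>A. lam i * \<pi> i j) - mu j"

text \<open>
  One stage of the decomposition, for a set \<open>P\<close> of policies, a set \<open>D\<close> of stations and
  the weighted drift \<open>f \<pi> j\<close>. These are meaningful for \<open>D \<noteq> {}\<close>.
\<close>

definition minimax_value :: "('p \<Rightarrow> 'n \<Rightarrow> real) \<Rightarrow> 'p set \<Rightarrow> 'n set \<Rightarrow> real" where
  "minimax_value f P D = (LEAST v. v \<in> (\<lambda>\<pi>. MAX j\<in>D. f \<pi> j) ` P)"

definition minimax_policies :: "('p \<Rightarrow> 'n \<Rightarrow> real) \<Rightarrow> 'p set \<Rightarrow> 'n set \<Rightarrow> 'p set" where
  "minimax_policies f P D = {\<pi> \<in> P. (MAX j\<in>D. f \<pi> j) = minimax_value f P D}"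

definition minimax_sets :: "('p \<Rightarrow> 'n \<Rightarrow> real) \<Rightarrow> 'p set \<Rightarrow> 'n set \<Rightarrow> 'n set set" where
  "minimax_sets f P D =
     (\<lambda>\<pi>. {j \<in> D. f \<pi> j = minimax_value f P D}) ` minimax_policies f P D"

definition minimax_cluster :: "('p \<Rightarrow> 'n \<Rightarrow> real) \<Rightarrow> 'p set \<Rightarrow> 'n set \<Rightarrow> 'n set" where
  "minimax_cluster f P D =
     (THE C. C \<in> minimax_sets f P D \<and> (\<forall>C' \<in> minimax_sets f P D. card C \<le> card C'))"

text \<open>\<open>hmd_stage f P k\<close> is the pair of the policy set \<open>\<Pi>\<^sub>k\<close> and the set \<open>D\<^sub>k\<^sub>+\<^sub>1\<close> of remaining
  stations, starting from \<open>\<Pi>\<^sub>0 = P\<close>.\<close>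

primrec hmd_stage :: "('p \<Rightarrow> 'n \<Rightarrow> real) \<Rightarrow> 'p set \<Rightarrow> nat \<Rightarrow> 'p set \<times> 'n set" where
  "hmd_stage f P 0 = (P, UNIV)"
| "hmd_stage f P (Suc k) =
     (let (Q, D) = hmd_stage f P k; C = minimax_cluster f Q D
      in ({\<pi> \<in> Q. (MAX j\<in>C. f \<pi> j) = minimax_value f Q D}, D - C))"

text \<open>The following refer to the clusters \<open>C\<^sub>k\<close> and rates \<open>V\<^sub>k\<close> with \<open>k \<ge> 1\<close>; hence the index
  \<open>k - 1\<close>.\<close>

definition hmd_rate :: "'i set \<Rightarrow> ('i \<Rightarrow> 'n::finite set) \<Rightarrow> ('i \<Rightarrow> real) \<Rightarrow> ('n \<Rightarrow> real)
    \<Rightarrow> ('n \<Rightarrow> real) \<Rightarrow> nat \<Rightarrow> real" where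
  "hmd_rate A S lam mu w k =
     (let f = (\<lambda>\<pi> j. w j * drift A lam mu \<pi> j);
          (Q, D) = hmd_stage f (static_policies A S) (k - 1)
      in minimax_value f Q D)"

definition hmd_cluster :: "'i set \<Rightarrow> ('i \<Rightarrow> 'n::finite set) \<Rightarrow> ('i \<Rightarrow> real) \<Rightarrow> ('n \<Rightarrow> real)
    \<Rightarrow> ('n \<Rightarrow> real) \<Rightarrow> nat \<Rightarrow> 'n set" where
  "hmd_cluster A S lam mu w k =
     (let f = (\<lambda>\<pi> j. w j * drift A lam mu \<pi> j);
          (Q, D) = hmd_stage f (static_policies A S) (k - 1)
      in minimax_cluster f Q D)"

definition hmd_length :: "'i set \<Rightarrow> ('i \<Rightarrow> 'n::finite set) \<Rightarrow> ('i \<Rightarrow> real) \<Rightarrow> ('n \<Rightarrow> real)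
    \<Rightarrow> ('n \<Rightarrow> real) \<Rightarrow> nat" where
  "hmd_length A S lam mu w =
     (LEAST k. snd (hmd_stage (\<lambda>\<pi> j. w j * drift A lam mu \<pi> j) (static_policies A S) k) = {})"

subsection \<open>The JLW transition rates\<close>

definition jlw_min :: "('i \<Rightarrow> 'n set) \<Rightarrow> ('n \<Rightarrow> real) \<Rightarrow> int ^ 'n::finite \<Rightarrow> 'i \<Rightarrow> 'n set" where
  "jlw_min S w x i =
     {j \<in> S i. w j * real_of_int (x $ j) = (MIN l\<in>S i. w l * real_of_int (x $ l))}"

definition jlw_prob :: "('i \<Rightarrow> 'n set) \<Rightarrow> ('n \<Rightarrow> real) \<Rightarrow> int ^ 'n::finite \<Rightarrow> 'i \<Rightarrow> 'n \<Rightarrow> real" where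
  "jlw_prob S w x i j =
     (if j \<in> jlw_min S w x i then 1 / real (card (jlw_min S w x i)) else 0)"

text \<open>For each \<open>y\<close> at most one summand below is nonzero, since the states
  \<open>x \<plusminus> e\<^sub>j\<close> are pairwise distinct.\<close>

definition jlw_rate :: "'i set \<Rightarrow> ('i \<Rightarrow> 'n set) \<Rightarrow> ('i \<Rightarrow> real) \<Rightarrow> ('n \<Rightarrow> real) \<Rightarrow> ('n \<Rightarrow> real)
    \<Rightarrow> int ^ 'n::finite \<Rightarrow> int ^ 'n \<Rightarrow> real" where
  "jlw_rate A S lam mu w x y =
     (\<Sum>j\<in>UNIV. if y = x + axis j 1 then \<Sum>i\<in>{i \<in> A. j \<in> S i}. lam i * jlw_prob S w x i j
               else if y = x - axis j 1 then mu j
               else 0)"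

subsection \<open>Continuous-time Markov chains\<close>

definition exit_rate :: "('s \<Rightarrow> 's \<Rightarrow> real) \<Rightarrow> 's \<Rightarrow> real" where
  "exit_rate q x = (\<Sum>\<^sub>\<infinity>y\<in>UNIV - {x}. q x y)"

definition jump_prob :: "('s \<Rightarrow> 's \<Rightarrow> real) \<Rightarrow> 's \<Rightarrow> 's \<Rightarrow> real" where
  "jump_prob q x y = (if y = x then 0 else q x y / exit_rate q x)"

text \<open>
  The jump-chain and holding-time definition of a continuous-time Markov chain \<open>X\<close> with
  transition rates \<open>q\<close> started at \<open>x0\<close>: the jump chain \<open>Y\<close> is a discrete-time Markov chain
  with transition probabilities \<open>jump_prob q\<close>, and given \<open>Y\<close> the holding times \<open>H n\<close> are
  independent and exponential with rates \<open>exit_rate q (Y n)\<close>. The displayed probabilities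
  determine the joint law of \<open>Y\<close> and \<open>H\<close>. The definition is for positive finite exit rates
  (no absorbing states), and the value of \<open>X\<close> after an explosion is left open; for the JLW
  rates the exit rate is the same positive number in every state, so there is no explosion.
\<close>

definition ctmc :: "'w measure \<Rightarrow> ('s::countable \<Rightarrow> 's \<Rightarrow> real) \<Rightarrow> 's \<Rightarrow> (real \<Rightarrow> 'w \<Rightarrow> 's) \<Rightarrow> bool" where
  "ctmc M q x0 X \<longleftrightarrow>
     prob_space M \<and>
     (\<forall>t\<ge>0. X t \<in> measurable M (count_space UNIV)) \<and>
     (\<exists>(Y :: nat \<Rightarrow> 'w \<Rightarrow> 's) (H :: nat \<Rightarrow> 'w \<Rightarrow> real).
        (\<forall>n. Y n \<in> measurable M (count_space UNIV)) \<and>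
        (\<forall>n. H n \<in> borel_measurable M) \<and>
        (\<forall>n y s. (\<forall>m<n. 0 \<le> s m) \<longrightarrow>
           measure M {\<omega> \<in> space M. (\<forall>m\<le>n. Y m \<omega> = y m) \<and> (\<forall>m<n. s m < H m \<omega>)} =
             (if y 0 = x0 then 1 else 0) *
             (\<Prod>m<n. jump_prob q (y m) (y (Suc m)) * exp (- exit_rate q (y m) * s m))) \<and>
        (AE \<omega> in M. \<forall>n t. (\<Sum>m<n. H m \<omega>) \<le> t \<and> t < (\<Sum>m\<le>n. H m \<omega>) \<longrightarrow> X t \<omega> = Y n \<omega>))"

end

theory Submission
  imports Defs
begin

text \<open>
  Write \<open>d j\<close> for the drift of station \<open>j\<close>. Call a static policy an equilibrium if each neighbourhood
  sends its arrivals only to those of its stations where the weighted drift \<open>w j * d j\<close> is smallest.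
  An equilibrium \<open>\<pi>\<close> exists (\<open>exists_equilibrium\<close>): it minimises the convex function \<open>\<Sum> w j * (d j)^2\<close>
  over the compact set of static policies, since otherwise moving a little mass would lower that
  function. Its weighted drifts describe the minimax decomposition completely: the stations with
  the largest weighted drifts receive only arrivals that cannot go elsewhere, so no policy can
  lower their total drift, and inductively the \<open>k\<close>-th cluster is the \<open>k\<close>-th highest level set of the
  weighted drift of \<open>\<pi>\<close> (\<open>hmd_cluster_equilibrium\<close>).

  The JLW walk is a stochastic analogue of a monotone flow for which \<open>x j = t * d j\<close> is a solution.
  In every state the JLW rule minimises \<open>\<Sum> c j * d j\<close> for the weights
  \<open>c j = w j * x j\<close>, while \<open>\<pi>\<close> minimises it for \<open>c j = w j * d j\<close>; adding the two inequalities
  (\<open>jlw_contracts_deviation\<close>) shows that the squared distance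
  \<open>\<Sum> w j * (x j - n * d j / total_rate)^2\<close> after \<open>n\<close> jumps has a one-step mean increase bounded by a
  constant, in every state. The mean squared distance therefore grows at most linearly
  (\<open>deviation_mean_linear\<close>), for all clusters at once.

  The total jump rate is the same in all states, so the holding times are independent
  exponentials, and the \<open>n\<close>-th jump time has variance of order \<open>n\<close> as well. A sequence with second moments
  of order \<open>n\<close> is almost surely of order \<open>m^3\<close> along \<open>n = m^4\<close>
  (\<open>quartic_subsequence_bound\<close>), and since neither sequence can drop quickly, it is of order
  \<open>n^(3/4)\<close> along all \<open>n\<close> (\<open>one_sided_increments_interpolate\<close>). Substituting the jump times for \<open>n\<close>
  gives the rate \<open>t^(-\<epsilon>)\<close> for every \<open>\<epsilon> < 1/4\<close>.
\<close>

section \<open>Equilibrium policies and the hierarchical minimax decomposition\<close>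

locale jlw_network =
  fixes A :: "'i set" and S :: "'i \<Rightarrow> 'n::finite set" and lam :: "'i \<Rightarrow> real"
    and mu w :: "'n \<Rightarrow> real"
  assumes finite_A: "finite A"
    and S_nonempty: "i \<in> A \<Longrightarrow> S i \<noteq> {}"
    and lam_pos: "i \<in> A \<Longrightarrow> lam i > 0"
    and mu_pos: "mu j > 0"
    and w_pos: "w j > 0"
begin

abbreviation V :: "('i \<Rightarrow> 'n \<Rightarrow> real) \<Rightarrow> 'n \<Rightarrow> real" where
  "V \<pi> j \<equiv> w j * drift A lam mu \<pi> j"

text \<open>
  With \<open>c = V \<pi>\<close> this says that \<open>\<pi>\<close> is an equilibrium; with \<open>c j = w j * x j\<close> it is the
  defining property of the JLW rule in state \<open>x\<close>.
\<close>
definition greedy :: "('n \<Rightarrow> real) \<Rightarrow> ('i \<Rightarrow> 'n \<Rightarrow> real) \<Rightarrow> bool" where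
  "greedy c \<pi> \<longleftrightarrow> \<pi> \<in> static_policies A S \<and>
     (\<forall>i\<in>A. \<forall>j. \<pi> i j > 0 \<longrightarrow> (\<forall>l\<in>S i. c j \<le> c l))"

lemma static_policiesD:
  assumes "\<pi> \<in> static_policies A S" "i \<in> A"
  shows "0 \<le> \<pi> i j" "(\<Sum>j\<in>UNIV. \<pi> i j) = 1" "j \<notin> S i \<Longrightarrow> \<pi> i j = 0"
  using assms by (auto simp: static_policies_def PiE_iff)

lemma sum_drift:
  "(\<Sum>j\<in>UNIV. c j * drift A lam mu \<pi> j) =
     (\<Sum>i\<in>A. lam i * (\<Sum>j\<in>UNIV. c j * \<pi> i j)) - (\<Sum>j\<in>UNIV. c j * mu j)"
proof -
  have "(\<Sum>j\<in>UNIV. c j * drift A lam mu \<pi> j) =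
      (\<Sum>j\<in>UNIV. \<Sum>i\<in>A. lam i * (c j * \<pi> i j)) - (\<Sum>j\<in>UNIV. c j * mu j)"
    by (simp add: drift_def right_diff_distrib sum_subtractf sum_distrib_left mult_ac)
  also have "(\<Sum>j\<in>UNIV. \<Sum>i\<in>A. lam i * (c j * \<pi> i j)) = (\<Sum>i\<in>A. lam i * (\<Sum>j\<in>UNIV. c j * \<pi> i j))"
    by (subst sum.swap) (simp add: sum_distrib_left)
  finally show ?thesis .
qed

text \<open>
  The weighted sum of drifts splits over the neighbourhoods, and in each of them it is the mean of
  \<open>c\<close> under the routing distribution, which is least when only minimisers of \<open>c\<close> are used.
\<close>
lemma greedy_minimises_weighted_drift:
  assumes "greedy c \<sigma>" and \<rho>: "\<rho> \<in> static_policies A S"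
  shows "(\<Sum>j\<in>UNIV. c j * drift A lam mu \<sigma> j) \<le> (\<Sum>j\<in>UNIV. c j * drift A lam mu \<rho> j)"
proof -
  have \<sigma>: "\<sigma> \<in> static_policies A S"
    and gr: "\<And>i j l. i \<in> A \<Longrightarrow> \<sigma> i j > 0 \<Longrightarrow> l \<in> S i \<Longrightarrow> c j \<le> c l"
    using assms(1) by (auto simp: greedy_def)
  have "(\<Sum>j\<in>UNIV. c j * \<sigma> i j) \<le> (\<Sum>j\<in>UNIV. c j * \<rho> i j)" if i: "i \<in> A" for i
  proof -
    note s = static_policiesD[OF \<sigma> i] and r = static_policiesD[OF \<rho> i]
    obtain j0 where j0: "\<sigma> i j0 \<noteq> 0"
      using s(2) by (metis sum.neutral zero_neq_one)
    then have pos: "\<sigma> i j0 > 0" and mem: "j0 \<in> S i"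
      using s(1)[of j0] s(3)[of j0] by auto
    have "(\<Sum>j\<in>UNIV. c j * \<sigma> i j) \<le> (\<Sum>j\<in>UNIV. c j0 * \<sigma> i j)"
    proof (rule sum_mono)
      fix j show "c j * \<sigma> i j \<le> c j0 * \<sigma> i j"
        using s(1)[of j] gr[OF i _ mem, of j]
        by (cases "\<sigma> i j = 0") (auto intro: mult_right_mono)
    qed
    also have "\<dots> = c j0"
      by (simp add: s(2) flip: sum_distrib_left)
    also have "\<dots> = (\<Sum>j\<in>UNIV. c j0 * \<rho> i j)"
      by (simp add: r(2) flip: sum_distrib_left)
    also have "\<dots> \<le> (\<Sum>j\<in>UNIV. c j * \<rho> i j)"
    proof (rule sum_mono)
      fix j show "c j0 * \<rho> i j \<le> c j * \<rho> i j"
        using r(1)[of j] r(3)[of j] gr[OF i pos, of j]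
        by (cases "j \<in> S i") (auto intro: mult_right_mono)
    qed
    finally show ?thesis .
  qed
  then show ?thesis
    unfolding sum_drift using lam_pos
    by (intro diff_right_mono sum_mono[where K = A] mult_left_mono[OF _ less_imp_le]) auto
qed

lemma static_policies_nonempty: "static_policies A S \<noteq> {}"
proof -
  define \<rho> where "\<rho> = (\<lambda>i\<in>A. \<lambda>j. if j = (SOME j. j \<in> S i) then 1 else (0::real))"
  have "(SOME j. j \<in> S i) \<in> S i" if "i \<in> A" for i
    using S_nonempty[OF that] by (simp add: some_in_eq)
  then have "\<rho> \<in> static_policies A S"
    unfolding static_policies_def \<rho>_def by auto
  then show ?thesis by blast
qed

text \<open>
  Policies are extensional functions on the index set \<open>A\<close>, so the suitable topology is the product
  over \<open>A\<close>; each factor is a simplex in \<open>'n \<Rightarrow> real\<close>.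
\<close>
lemma compactin_static_policies:
  "compactin (product_topology (\<lambda>_. euclidean) A) (static_policies A S)"
proof -
  have "compact {p :: 'n \<Rightarrow> real. (\<forall>j. 0 \<le> p j) \<and> (\<Sum>j\<in>UNIV. p j) = 1 \<and> (\<forall>j. j \<notin> T \<longrightarrow> p j = 0)}"
    (is "compact ?\<Delta>") for T
  proof -
    have "compactin (product_topology (\<lambda>_. euclidean) UNIV) (PiE (UNIV :: 'n set) (\<lambda>_. {0..1::real}))"
      by (subst compactin_PiE) auto
    then have box: "compact (PiE (UNIV :: 'n set) (\<lambda>_. {0..1::real}))"
      by (simp add: euclidean_product_topology)
    have c [continuous_intros]: "continuous_on UNIV (\<lambda>p :: 'n \<Rightarrow> real. p j)" for j
      by simp
    have "closed ?\<Delta>"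
      by (intro closed_Collect_conj closed_Collect_all closed_Collect_imp
          closed_Collect_le closed_Collect_eq continuous_intros) auto
    moreover have "?\<Delta> \<subseteq> PiE UNIV (\<lambda>_. {0..1})"
    proof
      fix p assume p: "p \<in> ?\<Delta>"
      then have "p j \<le> 1" for j
        using member_le_sum[of j UNIV p] by auto
      with p show "p \<in> PiE UNIV (\<lambda>_. {0..1})" by auto
    qed
    ultimately show ?thesis
      using compact_Int_closed[OF box, of ?\<Delta>] by (simp only: Int_absorb1)
  qed
  then show ?thesis
    unfolding static_policies_def by (subst compactin_PiE) auto
qed

lemma continuous_map_drift:
  "continuous_map (product_topology (\<lambda>_. euclidean) A) euclideanreal (\<lambda>\<pi>. drift A lam mu \<pi> j)"
proof -
  have "continuous_map (product_topology (\<lambda>_. euclidean) A) euclideanreal (\<lambda>\<pi>. \<pi> i j)" if "i \<in> A" for i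
  proof -
    have "continuous_map euclidean euclideanreal (\<lambda>p. p j)"
      by simp
    from continuous_map_compose[OF continuous_map_product_projection[OF that] this]
    show ?thesis by (simp add: o_def)
  qed
  then show ?thesis
    unfolding drift_def by (intro continuous_intros finite_A) auto
qed

lemma shift_mass_static:
  assumes \<pi>: "\<pi> \<in> static_policies A S" and i: "i \<in> A" and l: "l \<in> S i" "l \<noteq> j"
    and \<delta>: "0 \<le> \<delta>" "\<delta> \<le> \<pi> i j" 
  shows "\<pi>(i := (\<pi> i)(j := \<pi> i j - \<delta>, l := \<pi> i l + \<delta>)) \<in> static_policies A S" (is "?\<pi>' \<in> _")
    and "drift A lam mu (\<pi>(i := (\<pi> i)(j := \<pi> i j - \<delta>, l := \<pi> i l + \<delta>))) k =
      drift A lam mu \<pi> k + (if k = l then lam i * \<delta> else if k = j then - lam i * \<delta> else 0)"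
proof -
  note s = static_policiesD[OF \<pi> i]
  have e: "((\<pi> i)(j := \<pi> i j - \<delta>, l := \<pi> i l + \<delta>)) k =
      \<pi> i k + (if k = l then \<delta> else 0) - (if k = j then \<delta> else 0)" for k
    using l by auto
  define p where "p = (\<pi> i)(j := \<pi> i j - \<delta>, l := \<pi> i l + \<delta>)"
  have p: "p k = \<pi> i k + (if k = l then \<delta> else 0) - (if k = j then \<delta> else 0)" for k
    using e by (simp add: p_def)
  have "(\<Sum>k\<in>UNIV. p k) = 1"
    unfolding p sum.distrib sum_subtractf by (simp add: s(2))
  moreover have "0 \<le> p k" for k
    using s(1)[of k] \<delta> l(2) unfolding p by auto
  moreover have "p k = 0" if "k \<notin> S i" for k
    using s(3)[OF that] l(1) that \<delta> unfolding p by auto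
  ultimately show "?\<pi>' \<in> static_policies A S"
    using \<pi> i unfolding p_def[symmetric] static_policies_def
    by (auto simp: PiE_iff extensional_def)
  have "drift A lam mu ?\<pi>' k = (\<Sum>i'\<in>A. lam i' * \<pi> i' k +
     (if i' = i then lam i * ((if k = l then \<delta> else 0) - (if k = j then \<delta> else 0)) else 0)) - mu k"
    unfolding drift_def using l(2)
    by (intro arg_cong2[where f="(-)"] sum.cong refl) (simp add: algebra_simps)
  then show "drift A lam mu ?\<pi>' k =
      drift A lam mu \<pi> k + (if k = l then lam i * \<delta> else if k = j then - lam i * \<delta> else 0)"
    using finite_A i l by (auto simp: sum.distrib drift_def)
qed

text \<open>
  The gradient of \<open>\<Sum> w j * (d j)^2\<close> in the drifts is twice the weighted drift, so at a minimiser
  no neighbourhood can gain by moving mass to a station with a smaller weighted drift.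
\<close>
lemma exists_equilibrium: "\<exists>\<pi>. greedy (V \<pi>) \<pi>"
proof -
  define \<Phi> where "\<Phi> \<pi> = (\<Sum>j\<in>UNIV. w j * (drift A lam mu \<pi> j)\<^sup>2)" for \<pi>
  have "continuous_map (product_topology (\<lambda>_. euclidean) A) euclideanreal \<Phi>"
    unfolding \<Phi>_def by (intro continuous_intros continuous_map_drift) auto
  then have "compact (\<Phi> ` static_policies A S)"
    using image_compactin[OF compactin_static_policies] by fastforce
  from compact_attains_inf[OF this] static_policies_nonempty
  obtain \<pi> where \<pi>: "\<pi> \<in> static_policies A S"
    and min: "\<And>\<rho>. \<rho> \<in> static_policies A S \<Longrightarrow> \<Phi> \<pi> \<le> \<Phi> \<rho>"
    by auto
  have "V \<pi> j \<le> V \<pi> l" if i: "i \<in> A" and pos: "\<pi> i j > 0" and l: "l \<in> S i" for i j l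
  proof (rule ccontr)
    assume "\<not> V \<pi> j \<le> V \<pi> l"
    then have gap: "V \<pi> j - V \<pi> l > 0" and ne: "l \<noteq> j" by auto
    define W where "W = w j + w l"
    have W: "W > 0" using w_pos[of j] w_pos[of l] by (simp add: W_def)
    \<comment> \<open>The change of \<open>\<Phi>\<close> is a quadratic in \<open>\<delta>\<close> with negative slope at 0; this \<open>\<delta>\<close> is feasible
      and lies before its second root.\<close>
    define \<delta> where "\<delta> = min (\<pi> i j) ((V \<pi> j - V \<pi> l) / (lam i * W))"
    have d: "0 < \<delta>" "\<delta> \<le> \<pi> i j" and d2: "lam i * W * \<delta> \<le> V \<pi> j - V \<pi> l"
      using pos gap lam_pos[OF i] W by (auto simp: \<delta>_def min_def field_simps)
    let ?\<pi>' = "\<pi>(i := (\<pi> i)(j := \<pi> i j - \<delta>, l := \<pi> i l + \<delta>))"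
    let ?d = "drift A lam mu \<pi>"
    note sh = shift_mass_static[OF \<pi> i l ne less_imp_le[OF d(1)] d(2)]
    have "\<Phi> ?\<pi>' = (\<Sum>k\<in>UNIV. w k * (?d k)\<^sup>2 +
        (if k = l then w l * (2 * lam i * \<delta> * ?d l + (lam i * \<delta>)\<^sup>2) else 0) +
        (if k = j then w j * (- 2 * lam i * \<delta> * ?d j + (lam i * \<delta>)\<^sup>2) else 0))"
      unfolding \<Phi>_def sh(2) using ne
      by (intro sum.cong) (auto simp: power2_eq_square algebra_simps)
    also have "\<dots> = \<Phi> \<pi> + lam i * \<delta> * (lam i * W * \<delta> - 2 * (V \<pi> j - V \<pi> l))"
      unfolding sum.distrib by (simp add: \<Phi>_def W_def power2_eq_square algebra_simps)
    also have "\<dots> < \<Phi> \<pi>"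
      using d d2 gap lam_pos[OF i] by (simp add: mult_less_0_iff)
    finally show False using min[OF sh(1)] by simp
  qed
  with \<pi> show ?thesis by (auto simp: greedy_def)
qed

text \<open>
  An equilibrium is also greedy for the indicator of an upper set \<open>U\<close> of its weighted drifts: it
  serves \<open>U\<close> only from neighbourhoods contained in \<open>U\<close>.
\<close>
lemma equilibrium_minimises_top_drift:
  assumes eq: "greedy (V \<pi>) \<pi>" and \<sigma>: "\<sigma> \<in> static_policies A S"
    and up: "\<And>j l. j \<in> U \<Longrightarrow> V \<pi> j \<le> V \<pi> l \<Longrightarrow> l \<in> U"
  shows "(\<Sum>j\<in>U. drift A lam mu \<pi> j) \<le> (\<Sum>j\<in>U. drift A lam mu \<sigma> j)"
proof -
  have "greedy (\<lambda>j. if j \<in> U then 1 else 0) \<pi>"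
    unfolding greedy_def
  proof (intro conjI ballI allI impI)
    show "\<pi> \<in> static_policies A S" using eq unfolding greedy_def by blast
    fix i j l assume "i \<in> A" "\<pi> i j > 0" "l \<in> S i"
    then have "V \<pi> j \<le> V \<pi> l" using eq unfolding greedy_def by blast
    then have "j \<in> U \<Longrightarrow> l \<in> U" using up by blast
    then show "(if j \<in> U then 1 else 0) \<le> (if l \<in> U then 1 else (0::real))"
      by auto
  qed
  moreover have "(\<Sum>j\<in>UNIV. (if j \<in> U then 1 else 0) * drift A lam mu \<rho> j) =
      (\<Sum>j\<in>U. drift A lam mu \<rho> j)" for \<rho>
    by (intro sum.mono_neutral_cong_right) auto
  ultimately show ?thesis
    using greedy_minimises_weighted_drift[OF _ \<sigma>, of "\<lambda>j. if j \<in> U then 1 else 0" \<pi>] by simp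
qed

text \<open>
  One stage of the decomposition, when the previous stages have fixed the weighted drifts outside
  \<open>D\<close> to those of \<open>\<pi>\<close>. The total drift over the complement of \<open>D\<close> together with \<open>C\<close> is minimal at \<open>\<pi>\<close>,
  so a policy whose weighted drifts do not exceed \<open>c\<close> on \<open>C\<close> has them all equal to \<open>c\<close>. Hence \<open>c\<close> is
  the minimax value, every minimising policy attains it on \<open>C\<close>, and within \<open>D\<close>
  the policy \<open>\<pi>\<close> attains it exactly on \<open>C\<close>.
\<close>
lemma minimax_stage:
  assumes eq: "greedy (V \<pi>) \<pi>" and D: "D \<noteq> {}"
    and sep: "\<And>j l. j \<notin> D \<Longrightarrow> l \<in> D \<Longrightarrow> V \<pi> l < V \<pi> j"
  defines "P \<equiv> \<lambda>D. {\<sigma> \<in> static_policies A S. \<forall>j\<in>-D. V \<sigma> j = V \<pi> j}"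
    and "c \<equiv> MAX j\<in>D. V \<pi> j"
  defines "C \<equiv> {j\<in>D. V \<pi> j = c}"
  shows "minimax_value V (P D) D = c"
    and "minimax_cluster V (P D) D = C"
    and "{\<sigma> \<in> P D. (MAX j\<in>C. V \<sigma> j) = c} = P (D - C)"
proof -
  have \<pi>: "\<pi> \<in> static_policies A S" using eq unfolding greedy_def by blast
  then have \<pi>P: "\<pi> \<in> P D" by (simp add: P_def)
  have le_c: "V \<pi> j \<le> c" if "j \<in> D" for j
    unfolding c_def using that by (intro Max_ge) auto
  have "c \<in> V \<pi> ` D" unfolding c_def using D by (intro Max_in) auto
  then have C: "C \<noteq> {}" by (auto simp: C_def)
  have rigid: "V \<sigma> j = c" if \<sigma>: "\<sigma> \<in> P D" and le: "\<And>j. j \<in> C \<Longrightarrow> V \<sigma> j \<le> c" and j: "j \<in> C" for \<sigma> j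
  proof (rule ccontr)
    assume "V \<sigma> j \<noteq> c"
    let ?d = "drift A lam mu"
    have "(\<Sum>j\<in>-D \<union> C. ?d \<pi> j) \<le> (\<Sum>j\<in>-D \<union> C. ?d \<sigma> j)"
    proof (rule equilibrium_minimises_top_drift[OF eq])
      show "\<sigma> \<in> static_policies A S" using \<sigma> by (simp add: P_def)
      show "l \<in> - D \<union> C" if "j \<in> - D \<union> C" "V \<pi> j \<le> V \<pi> l" for j l
        using that sep[of j l] le_c[of l] by (force simp: C_def)
    qed
    moreover have "(\<Sum>j\<in>-D \<union> C. ?d \<rho> j) = (\<Sum>j\<in>-D. ?d \<rho> j) + (\<Sum>j\<in>C. ?d \<rho> j)" for \<rho>
      by (rule sum.union_disjoint) (auto simp: C_def)
    moreover have "(\<Sum>j\<in>-D. ?d \<sigma> j) = (\<Sum>j\<in>-D. ?d \<pi> j)"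
    proof (rule sum.cong)
      fix k assume "k \<in> -D"
      then have "V \<sigma> k = V \<pi> k" using \<sigma> unfolding P_def by blast
      then show "?d \<sigma> k = ?d \<pi> k" using w_pos[of k] by simp
    qed simp
    ultimately have "(\<Sum>j\<in>C. ?d \<pi> j) \<le> (\<Sum>j\<in>C. ?d \<sigma> j)" by simp
    moreover have "(\<Sum>j\<in>C. ?d \<sigma> j) < (\<Sum>j\<in>C. ?d \<pi> j)"
    proof (rule sum_strict_mono_ex1)
      have Vc: "V \<pi> k = c" if "k \<in> C" for k using that unfolding C_def by blast
      have "?d \<sigma> k \<le> ?d \<pi> k" if "k \<in> C" for k
      proof -
        have "V \<sigma> k \<le> V \<pi> k" using le[OF that] Vc[OF that] by (rule ord_le_eq_trans[OF _ sym])
        then show ?thesis using w_pos[of k] by simp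
      qed
      then show "\<forall>k\<in>C. ?d \<sigma> k \<le> ?d \<pi> k" by blast
      have "V \<sigma> j < V \<pi> j"
        using le[OF j] Vc[OF j] \<open>V \<sigma> j \<noteq> c\<close> by linarith
      then have "?d \<sigma> j < ?d \<pi> j" using w_pos[of j] by simp
      then show "\<exists>k\<in>C. ?d \<sigma> k < ?d \<pi> k" using j by blast
    qed simp
    ultimately show False by simp
  qed
  have CD: "C \<subseteq> D" by (auto simp: C_def)
  have le_Max: "V \<sigma> j \<le> (MAX j\<in>E. V \<sigma> j)" if "j \<in> E" for \<sigma> j E
    using that by (intro Max_ge) auto
  show val: "minimax_value V (P D) D = c"
    unfolding minimax_value_def
  proof (rule Least_equality)
    show "c \<in> (\<lambda>\<pi>. MAX j\<in>D. V \<pi> j) ` P D" using \<pi>P by (auto simp: c_def)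
    fix v assume "v \<in> (\<lambda>\<pi>. MAX j\<in>D. V \<pi> j) ` P D"
    then obtain \<sigma> where \<sigma>: "\<sigma> \<in> P D" "v = (MAX j\<in>D. V \<sigma> j)" by auto
    show "c \<le> v"
    proof (rule ccontr)
      assume "\<not> c \<le> v"
      then have *: "V \<sigma> j < c" if "j \<in> C" for j
        using le_Max[of j D \<sigma>] \<sigma>(2) that CD by fastforce
      then show False using rigid[OF \<sigma>(1)] C by (force intro: less_imp_le)
    qed
  qed
  have sets: "C \<in> minimax_sets V (P D) D" "\<And>B. B \<in> minimax_sets V (P D) D \<Longrightarrow> C \<subseteq> B"
  proof -
    show "C \<in> minimax_sets V (P D) D"
      unfolding minimax_sets_def minimax_policies_def val
      using \<pi>P by (auto simp: C_def c_def intro!: image_eqI[where x=\<pi>])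
    fix B assume "B \<in> minimax_sets V (P D) D"
    then obtain \<sigma> where \<sigma>: "\<sigma> \<in> P D" "(MAX j\<in>D. V \<sigma> j) = c" "B = {j\<in>D. V \<sigma> j = c}"
      unfolding minimax_sets_def minimax_policies_def val by auto
    have "V \<sigma> j = c" if "j \<in> C" for j
      by (rule rigid[OF \<sigma>(1) _ that]) (use le_Max[of _ D \<sigma>] \<sigma>(2) CD in auto)
    then show "C \<subseteq> B" using \<sigma>(3) CD by auto
  qed
  show "minimax_cluster V (P D) D = C"
    unfolding minimax_cluster_def
  proof (rule the_equality)
    show "C \<in> minimax_sets V (P D) D \<and> (\<forall>C'\<in>minimax_sets V (P D) D. card C \<le> card C')"
      using sets card_mono[OF finite[of "_ :: 'n set"]] by blast
    fix B assume "B \<in> minimax_sets V (P D) D \<and> (\<forall>C'\<in>minimax_sets V (P D) D. card B \<le> card C')"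
    then have "C \<subseteq> B" "card B \<le> card C" using sets by blast+
    then show "B = C" using card_seteq[of B C] by simp
  qed
  show "{\<sigma> \<in> P D. (MAX j\<in>C. V \<sigma> j) = c} = P (D - C)"
  proof (intro set_eqI iffI)
    fix \<sigma> assume "\<sigma> \<in> {\<sigma> \<in> P D. (MAX j\<in>C. V \<sigma> j) = c}"
    then have \<sigma>: "\<sigma> \<in> P D" "(MAX j\<in>C. V \<sigma> j) = c" by auto
    have "V \<sigma> j = c" if "j \<in> C" for j
      by (rule rigid[OF \<sigma>(1) _ that]) (use le_Max[of _ C \<sigma>] \<sigma>(2) in auto)
    then have "V \<sigma> j = V \<pi> j" if "j \<in> C" for j using that unfolding C_def by simp
    with \<sigma>(1) show "\<sigma> \<in> P (D - C)" unfolding P_def by blast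
  next
    fix \<sigma> assume \<sigma>: "\<sigma> \<in> P (D - C)"
    then have "V \<sigma> j = V \<pi> j" if "j \<in> C" for j using that unfolding P_def by blast
    then have "V \<sigma> j = c" if "j \<in> C" for j using that unfolding C_def by simp
    then have "V \<sigma> ` C = {c}" using C by blast
    moreover have "\<sigma> \<in> P D" using \<sigma> unfolding P_def by blast
    ultimately show "\<sigma> \<in> {\<sigma> \<in> P D. (MAX j\<in>C. V \<sigma> j) = c}" by simp
  qed
qed

text \<open>
  Each stage peels off the highest remaining level set of \<open>V \<pi>\<close>, so \<open>minimax_stage\<close> can be iterated.
  The assumption that stations remain holds up to stage \<open>hmd_length A S lam mu w\<close>, which is the least
  stage without remaining stations.
\<close>
lemma hmd_stage_equilibrium:
  assumes eq: "greedy (V \<pi>) \<pi>"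
    and "\<And>m. m < k \<Longrightarrow> snd (hmd_stage V (static_policies A S) m) \<noteq> {}"
  defines "D \<equiv> snd (hmd_stage V (static_policies A S) k)"
  shows "fst (hmd_stage V (static_policies A S) k) =
      {\<sigma> \<in> static_policies A S. \<forall>j\<in>-D. V \<sigma> j = V \<pi> j} \<and>
    (\<forall>j l. j \<notin> D \<longrightarrow> l \<in> D \<longrightarrow> V \<pi> l < V \<pi> j)"
  using assms(2) unfolding D_def
proof (induction k)
  case 0
  then show ?case by simp
next
  case (Suc k)
  define Q D where "Q = fst (hmd_stage V (static_policies A S) k)"
    and "D = snd (hmd_stage V (static_policies A S) k)"
  have QD: "hmd_stage V (static_policies A S) k = (Q, D)" by (simp add: Q_def D_def)
  have Q: "Q = {\<sigma> \<in> static_policies A S. \<forall>j\<in>-D. V \<sigma> j = V \<pi> j}"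
    and sep: "\<And>j l. j \<notin> D \<Longrightarrow> l \<in> D \<Longrightarrow> V \<pi> l < V \<pi> j"
    using Suc.IH Suc.prems by (auto simp: QD)
  have D: "D \<noteq> {}" using Suc.prems[of k] by (simp add: QD)
  note st = minimax_stage[OF eq D sep, folded Q]
  have "V \<pi> l \<le> (MAX j\<in>D. V \<pi> j)" if "l \<in> D" for l using that by (intro Max_ge) auto
  then show ?case
    using sep by (auto simp: QD st Let_def less_le)
qed

lemma hmd_cluster_equilibrium:
  assumes eq: "greedy (V \<pi>) \<pi>" and k: "k \<in> {1..hmd_length A S lam mu w}"
    and j: "j \<in> hmd_cluster A S lam mu w k"
  shows "hmd_rate A S lam mu w k = V \<pi> j"
proof -
  obtain m where m: "k = Suc m" using k by (cases k) auto
  define Q D where "Q = fst (hmd_stage V (static_policies A S) m)"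
    and "D = snd (hmd_stage V (static_policies A S) m)"
  have QD: "hmd_stage V (static_policies A S) m = (Q, D)" by (simp add: Q_def D_def)
  have ne: "snd (hmd_stage V (static_policies A S) i) \<noteq> {}" if "i < k" for i
  proof -
    have "i < hmd_length A S lam mu w" using that k by simp
    then show ?thesis unfolding hmd_length_def by (rule not_less_Least)
  qed
  have D: "D \<noteq> {}" using ne[of m] unfolding m QD by simp
  have "snd (hmd_stage V (static_policies A S) i) \<noteq> {}" if "i < m" for i
    using ne[of i] that m by simp
  then have inv: "Q = {\<sigma> \<in> static_policies A S. \<forall>j\<in>-D. V \<sigma> j = V \<pi> j} \<and>
      (\<forall>j l. j \<notin> D \<longrightarrow> l \<in> D \<longrightarrow> V \<pi> l < V \<pi> j)"
    unfolding Q_def D_def by (rule hmd_stage_equilibrium[OF eq])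
  have Q: "Q = {\<sigma> \<in> static_policies A S. \<forall>j\<in>-D. V \<sigma> j = V \<pi> j}"
    by (rule conjunct1[OF inv])
  have sep: "\<And>j l. j \<notin> D \<Longrightarrow> l \<in> D \<Longrightarrow> V \<pi> l < V \<pi> j"
    using conjunct2[OF inv] by blast
  have "minimax_value V Q D = (MAX j\<in>D. V \<pi> j)"
    unfolding Q by (rule minimax_stage(1)[OF eq D]) (rule sep)
  then have rate: "hmd_rate A S lam mu w k = (MAX j\<in>D. V \<pi> j)"
    by (simp add: hmd_rate_def m QD)
  have "minimax_cluster V Q D = {j\<in>D. V \<pi> j = (MAX j\<in>D. V \<pi> j)}"
    unfolding Q by (rule minimax_stage(2)[OF eq D]) (rule sep)
  then have "hmd_cluster A S lam mu w k = {j\<in>D. V \<pi> j = (MAX j\<in>D. V \<pi> j)}"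
    by (simp add: hmd_cluster_def m QD)
  with j rate show ?thesis by simp
qed

section \<open>A quadratic Lyapunov function for the JLW walk\<close>

definition jlw_policy :: "int ^ 'n \<Rightarrow> 'i \<Rightarrow> 'n \<Rightarrow> real" where
  "jlw_policy x = (\<lambda>i\<in>A. jlw_prob S w x i)"

definition total_rate :: real where
  "total_rate = (\<Sum>i\<in>A. lam i) + (\<Sum>j\<in>UNIV. mu j)"

abbreviation rate :: "int ^ 'n \<Rightarrow> int ^ 'n \<Rightarrow> real" where
  "rate \<equiv> jlw_rate A S lam mu w"

definition neighbours :: "int ^ 'n \<Rightarrow> (int ^ 'n) set" where
  "neighbours x = range (\<lambda>j. x + axis j 1) \<union> range (\<lambda>j. x - axis j 1)"

lemma total_rate_pos: "total_rate > 0"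
  unfolding total_rate_def using mu_pos lam_pos
  by (intro add_nonneg_pos sum_nonneg sum_pos) (auto intro: less_imp_le)

lemma finite_neighbours: "finite (neighbours x)"
  by (simp add: neighbours_def)

lemma axis_one_nonzero: "axis (j :: 'n) (1 :: int) \<noteq> 0"
  by (simp add: axis_eq_0_iff)

lemma not_self_neighbour: "x \<notin> neighbours x"
  using axis_one_nonzero by (auto simp: neighbours_def)

lemma neighbours_coordinate:
  "y \<in> neighbours x \<Longrightarrow> \<bar>y $ j - x $ j\<bar> \<le> 1"
  by (auto simp: neighbours_def axis_def)

lemma jlw_policy_greedy:
  "greedy (\<lambda>j. w j * real_of_int (x $ j)) (jlw_policy x)"
proof -
  have p: "jlw_prob S w x i \<in> {p. (\<forall>j. 0 \<le> p j) \<and> (\<Sum>j\<in>UNIV. p j) = 1 \<and> (\<forall>j. j \<notin> S i \<longrightarrow> p j = 0)}"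
    if i: "i \<in> A" for i
  proof -
    let ?f = "\<lambda>l. w l * real_of_int (x $ l)"
    have "(MIN l\<in>S i. ?f l) \<in> ?f ` S i"
      using S_nonempty[OF i] by (intro Min_in) auto
    then have "jlw_min S w x i \<noteq> {}"
      unfolding jlw_min_def by fastforce
    then show ?thesis
      by (auto simp: jlw_prob_def sum.If_cases jlw_min_def)
  qed
  then have "jlw_policy x \<in> static_policies A S"
    unfolding static_policies_def jlw_policy_def by auto
  moreover have "w j * real_of_int (x $ j) \<le> w l * real_of_int (x $ l)"
    if "i \<in> A" "jlw_policy x i j > 0" "l \<in> S i" for i j l
  proof -
    have "j \<in> jlw_min S w x i"
      using that by (auto simp: jlw_policy_def jlw_prob_def split: if_splits)
    then have "w j * real_of_int (x $ j) = (MIN l\<in>S i. w l * real_of_int (x $ l))"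
      by (simp add: jlw_min_def)
    also have "\<dots> \<le> w l * real_of_int (x $ l)"
      using that by (intro Min_le) auto
    finally show ?thesis .
  qed
  ultimately show ?thesis by (simp add: greedy_def)
qed

lemma jlw_policy_static: "jlw_policy x \<in> static_policies A S"
  using jlw_policy_greedy unfolding greedy_def by blast

abbreviation arrival :: "int ^ 'n \<Rightarrow> 'n \<Rightarrow> real" where
  "arrival x j \<equiv> drift A lam mu (jlw_policy x) j + mu j"

lemma arrival_eq: "(\<Sum>i\<in>{i \<in> A. j \<in> S i}. lam i * jlw_prob S w x i j) = arrival x j"
  unfolding drift_def diff_add_cancel
  by (intro sum.mono_neutral_cong_left)
     (auto simp: finite_A jlw_policy_def jlw_prob_def jlw_min_def)

lemma arrival_nonneg: "arrival x j \<ge> 0"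
  unfolding drift_def diff_add_cancel
  using lam_pos static_policiesD(1)[OF jlw_policy_static]
  by (intro sum_nonneg mult_nonneg_nonneg) (auto intro: less_imp_le)

lemma sum_event_rates: "(\<Sum>j\<in>UNIV. arrival x j + mu j) = total_rate"
proof -
  have "(\<Sum>j\<in>UNIV. drift A lam mu (jlw_policy x) j) = (\<Sum>i\<in>A. lam i) - (\<Sum>j\<in>UNIV. mu j)"
    using sum_drift[of "\<lambda>_. 1" "jlw_policy x"] static_policiesD(2)[OF jlw_policy_static]
    by simp
  then show ?thesis by (simp add: sum.distrib total_rate_def flip: sum_distrib_left)
qed

lemma rate_eq:
  "rate x y = (\<Sum>j\<in>UNIV. (if y = x + axis j 1 then arrival x j else 0) +
                         (if y = x - axis j 1 then mu j else 0))"
proof -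
  have "x + axis j 1 \<noteq> x - axis j 1" for j
  proof
    assume "x + axis j 1 = x - axis j 1"
    from arg_cong[OF this, of "\<lambda>z. z $ j"] show False by (simp add: axis_def)
  qed
  then show ?thesis
    unfolding jlw_rate_def arrival_eq by (intro sum.cong) auto
qed

lemma rate_nonneg: "rate x y \<ge> 0"
  unfolding rate_eq using arrival_nonneg mu_pos
  by (intro sum_nonneg add_nonneg_nonneg) (auto intro: less_imp_le)

lemma rate_outside: "y \<notin> neighbours x \<Longrightarrow> rate x y = 0"
  unfolding rate_eq by (intro sum.neutral) (auto simp: neighbours_def)

lemma sum_rate:
  fixes g :: "int ^ 'n \<Rightarrow> real"
  shows "(\<Sum>y\<in>neighbours x. rate x y * g y) =
    (\<Sum>j\<in>UNIV. arrival x j * g (x + axis j 1) + mu j * g (x - axis j 1))"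
proof -
  have "(\<Sum>y\<in>neighbours x. rate x y * g y) =
      (\<Sum>y\<in>neighbours x. \<Sum>j\<in>UNIV. (if y = x + axis j 1 then arrival x j * g y else 0) +
                         (if y = x - axis j 1 then mu j * g y else 0))"
    unfolding rate_eq sum_distrib_right distrib_right if_distrib[where f="\<lambda>a. a * _"] mult_zero_left ..
  also have "\<dots> = (\<Sum>j\<in>UNIV. \<Sum>y\<in>neighbours x. (if y = x + axis j 1 then arrival x j * g y else 0) +
                         (if y = x - axis j 1 then mu j * g y else 0))"
    by (rule sum.swap)
  also have "\<dots> = (\<Sum>j\<in>UNIV. arrival x j * g (x + axis j 1) + mu j * g (x - axis j 1))"
  proof (rule sum.cong)
    fix j :: 'n
    have "x + axis j 1 \<in> neighbours x" "x - axis j 1 \<in> neighbours x"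
      by (auto simp: neighbours_def)
    then show "(\<Sum>y\<in>neighbours x. (if y = x + axis j 1 then arrival x j * g y else 0) +
          (if y = x - axis j 1 then mu j * g y else 0)) =
        arrival x j * g (x + axis j 1) + mu j * g (x - axis j 1)"
      using finite_neighbours unfolding sum.distrib by (simp only: sum.delta if_True)
  qed simp
  finally show ?thesis .
qed

lemma exit_rate_eq: "exit_rate rate x = total_rate"
proof -
  have "exit_rate rate x = (\<Sum>\<^sub>\<infinity>y\<in>neighbours x. rate x y)"
    unfolding exit_rate_def
    using not_self_neighbour rate_outside by (intro infsum_cong_neutral) auto
  also have "\<dots> = (\<Sum>y\<in>neighbours x. rate x y)"
    using finite_neighbours by (rule infsum_finite)
  also have "\<dots> = total_rate"
    using sum_rate[of x "\<lambda>_. 1"] sum_event_rates[of x] by simp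
  finally show ?thesis .
qed

lemma jump_prob_eq: "jump_prob rate x y = rate x y / total_rate"
  using rate_outside[OF not_self_neighbour] by (simp add: jump_prob_def exit_rate_eq)

definition kernel :: "int ^ 'n \<Rightarrow> (int ^ 'n) pmf" where
  "kernel x = embed_pmf (jump_prob rate x)"

lemma pmf_kernel: "pmf (kernel x) y = jump_prob rate x y"
  unfolding kernel_def
proof (rule pmf_embed_pmf)
  show "0 \<le> jump_prob rate x y" for y
    using rate_nonneg total_rate_pos by (simp add: jump_prob_eq)
  have "(\<integral>\<^sup>+ y. ennreal (jump_prob rate x y) \<partial>count_space UNIV) =
      (\<Sum>y\<in>neighbours x. ennreal (jump_prob rate x y))"
    using rate_outside by (intro nn_integral_count_space'[OF finite_neighbours]) (auto simp: jump_prob_eq)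
  also have "\<dots> = ennreal (\<Sum>y\<in>neighbours x. jump_prob rate x y)"
    using rate_nonneg total_rate_pos by (intro sum_ennreal) (simp add: jump_prob_eq)
  also have "(\<Sum>y\<in>neighbours x. jump_prob rate x y) = 1"
    using sum_rate[of x "\<lambda>_. 1"] sum_event_rates[of x] total_rate_pos
    by (simp add: jump_prob_eq flip: sum_divide_distrib)
  finally show "(\<integral>\<^sup>+ y. ennreal (jump_prob rate x y) \<partial>count_space UNIV) = 1" by simp
qed

lemma set_pmf_kernel: "set_pmf (kernel x) \<subseteq> neighbours x"
  using rate_outside[of _ x] by (force simp: set_pmf_iff pmf_kernel jump_prob_eq)

lemma nn_integral_kernel:
  assumes "\<And>y. 0 \<le> g y"
  shows "(\<integral>\<^sup>+ y. ennreal (g y) \<partial>kernel x) =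
    ennreal ((\<Sum>j\<in>UNIV. arrival x j * g (x + axis j 1) + mu j * g (x - axis j 1)) / total_rate)"
proof -
  have "(\<integral>\<^sup>+ y. ennreal (g y) \<partial>kernel x) =
      (\<Sum>y\<in>neighbours x. ennreal (g y) * ennreal (pmf (kernel x) y))"
    using set_pmf_kernel by (intro nn_integral_measure_pmf_support finite_neighbours) auto
  also have "\<dots> = (\<Sum>y\<in>neighbours x. ennreal (rate x y * g y / total_rate))"
    using assms by (intro sum.cong refl) 
      (simp add: pmf_kernel jump_prob_eq ennreal_mult[symmetric] rate_nonneg total_rate_pos less_imp_le mult_ac)
  also have "\<dots> = ennreal (\<Sum>y\<in>neighbours x. rate x y * g y / total_rate)"
    using assms rate_nonneg total_rate_pos by (intro sum_ennreal) auto
  also have "(\<Sum>y\<in>neighbours x. rate x y * g y / total_rate) =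
      (\<Sum>j\<in>UNIV. arrival x j * g (x + axis j 1) + mu j * g (x - axis j 1)) / total_rate"
    unfolding sum_rate[symmetric] sum_divide_distrib ..
  finally show ?thesis .
qed

text \<open>
  Under \<open>\<pi>\<close> the mean displacement of queue \<open>j\<close> per jump is \<open>drift A lam mu \<pi> j / total_rate\<close>.
\<close>
definition deviation :: "('i \<Rightarrow> 'n \<Rightarrow> real) \<Rightarrow> nat \<Rightarrow> int ^ 'n \<Rightarrow> real" where
  "deviation \<pi> n x =
     (\<Sum>j\<in>UNIV. w j * (real_of_int (x $ j) - real n * drift A lam mu \<pi> j / total_rate)\<^sup>2)"

text \<open>
  Two optimality statements are added: JLW is greedy for \<open>w j * x j\<close>, and \<open>\<pi>\<close> is greedy for its own
  weighted drifts. This monotonicity keeps the walk from drifting away from the line on which the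
  weighted queues are \<open>s * V \<pi>\<close>.
\<close>
lemma jlw_contracts_deviation:
  assumes eq: "greedy (V \<pi>) \<pi>" and "0 \<le> s"
  shows "(\<Sum>j\<in>UNIV. (w j * real_of_int (x $ j) - s * V \<pi> j) *
      (drift A lam mu (jlw_policy x) j - drift A lam mu \<pi> j)) \<le> 0"
proof -
  let ?d = "drift A lam mu" and ?c = "\<lambda>j. w j * real_of_int (x $ j)"
  have \<pi>: "\<pi> \<in> static_policies A S" using eq unfolding greedy_def by blast
  have a: "(\<Sum>j\<in>UNIV. ?c j * ?d (jlw_policy x) j) \<le> (\<Sum>j\<in>UNIV. ?c j * ?d \<pi> j)"
    by (rule greedy_minimises_weighted_drift[OF jlw_policy_greedy \<pi>])
  have "(\<Sum>j\<in>UNIV. V \<pi> j * ?d \<pi> j) \<le> (\<Sum>j\<in>UNIV. V \<pi> j * ?d (jlw_policy x) j)"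
    by (rule greedy_minimises_weighted_drift[OF eq jlw_policy_static])
  then have b: "s * (\<Sum>j\<in>UNIV. V \<pi> j * ?d \<pi> j) \<le> s * (\<Sum>j\<in>UNIV. V \<pi> j * ?d (jlw_policy x) j)"
    using \<open>0 \<le> s\<close> by (rule mult_left_mono)
  have "(\<Sum>j\<in>UNIV. (?c j - s * V \<pi> j) * (?d (jlw_policy x) j - ?d \<pi> j)) =
      ((\<Sum>j\<in>UNIV. ?c j * ?d (jlw_policy x) j) - (\<Sum>j\<in>UNIV. ?c j * ?d \<pi> j)) +
      (s * (\<Sum>j\<in>UNIV. V \<pi> j * ?d \<pi> j) - s * (\<Sum>j\<in>UNIV. V \<pi> j * ?d (jlw_policy x) j))"
    unfolding sum_distrib_left sum_subtractf[symmetric] sum.distrib[symmetric]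
    by (intro sum.cong refl) (simp add: algebra_simps)
  with a b show ?thesis by linarith
qed

text \<open>
  Expanding the square around the point \<open>y\<close> below, the cross terms are at most those of \<open>\<pi>\<close> by
  contraction, which cancels the motion of the reference point; the jumps of unit size contribute
  at most \<open>\<Sum> w j\<close>.
\<close>
lemma deviation_step:
  assumes eq: "greedy (V \<pi>) \<pi>"
  shows "(\<integral>\<^sup>+ y. ennreal (deviation \<pi> (Suc n) y) \<partial>kernel x)
    \<le> ennreal (deviation \<pi> n x) + ennreal (\<Sum>j\<in>UNIV. w j)"
proof -
  let ?\<Lambda> = total_rate and ?d = "drift A lam mu"
  define u where "u j = ?d \<pi> j / ?\<Lambda>" for j
  \<comment> \<open>The expansion is around the reference point after \<open>Suc n\<close> jumps: moving it back by \<open>u\<close> then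
    produces a quadratic term in \<open>u\<close> of negative sign.\<close>
  define y where "y j = real_of_int (x $ j) - real (Suc n) * u j" for j
  define Q where "Q = (\<Sum>j\<in>UNIV. w j * (y j)\<^sup>2)"
  have dev: "deviation \<pi> m z = (\<Sum>j\<in>UNIV. w j * (real_of_int (z $ j) - real m * u j)\<^sup>2)" for m z
    by (simp add: deviation_def u_def)
  have dev_nonneg: "0 \<le> deviation \<pi> m z" for m z
    unfolding deviation_def using w_pos by (intro sum_nonneg) (simp add: less_imp_le)
  have up: "deviation \<pi> (Suc n) (x + axis k 1) = Q + (2 * w k * y k + w k)" for k
  proof -
    have "deviation \<pi> (Suc n) (x + axis k 1) =
        (\<Sum>j\<in>UNIV. w j * (y j)\<^sup>2 + (if j = k then 2 * w k * y k + w k else 0))"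
      unfolding dev by (intro sum.cong refl) (auto simp: y_def axis_def power2_eq_square algebra_simps)
    then show ?thesis by (simp add: sum.distrib Q_def)
  qed
  have down: "deviation \<pi> (Suc n) (x - axis k 1) = Q + (w k - 2 * w k * y k)" for k
  proof -
    have "deviation \<pi> (Suc n) (x - axis k 1) =
        (\<Sum>j\<in>UNIV. w j * (y j)\<^sup>2 + (if j = k then w k - 2 * w k * y k else 0))"
      unfolding dev by (intro sum.cong refl) (auto simp: y_def axis_def power2_eq_square algebra_simps)
    then show ?thesis by (simp add: sum.distrib Q_def)
  qed
  have "(\<Sum>j\<in>UNIV. arrival x j * deviation \<pi> (Suc n) (x + axis j 1) +
        mu j * deviation \<pi> (Suc n) (x - axis j 1)) =
      (\<Sum>j\<in>UNIV. Q * (arrival x j + mu j) + 2 * (w j * y j * ?d (jlw_policy x) j) +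
        w j * (arrival x j + mu j))"
    unfolding up down by (intro sum.cong refl) (simp add: algebra_simps)
  also have "\<dots> = Q * ?\<Lambda> + 2 * (\<Sum>j\<in>UNIV. w j * y j * ?d (jlw_policy x) j) +
      (\<Sum>j\<in>UNIV. w j * (arrival x j + mu j))"
    unfolding sum.distrib sum_distrib_left[symmetric] sum_event_rates[of x, unfolded sum.distrib]
    by (simp add: sum.distrib sum_event_rates[of x, unfolded sum.distrib])
  also have "(\<Sum>j\<in>UNIV. w j * (arrival x j + mu j)) \<le> (\<Sum>j\<in>UNIV. w j * ?\<Lambda>)"
  proof (intro sum_mono mult_left_mono)
    fix j :: 'n
    have "arrival x j + mu j \<le> (\<Sum>j\<in>UNIV. arrival x j + mu j)"
      by (rule member_le_sum[OF UNIV_I add_nonneg_nonneg[OF arrival_nonneg less_imp_le[OF mu_pos]] finite])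
    then show "arrival x j + mu j \<le> ?\<Lambda>" by (simp only: sum_event_rates)
  qed (use w_pos less_imp_le in auto)
  also have "(\<Sum>j\<in>UNIV. w j * y j * ?d (jlw_policy x) j) \<le> (\<Sum>j\<in>UNIV. w j * y j * ?d \<pi> j)"
  proof -
    have "(\<Sum>j\<in>UNIV. w j * y j * ?d (jlw_policy x) j) - (\<Sum>j\<in>UNIV. w j * y j * ?d \<pi> j) =
        (\<Sum>j\<in>UNIV. (w j * real_of_int (x $ j) - real (Suc n) / ?\<Lambda> * V \<pi> j) *
          (?d (jlw_policy x) j - ?d \<pi> j))"
      unfolding sum_subtractf[symmetric]
      by (intro sum.cong refl)
        (simp add: y_def u_def algebra_simps add_divide_distrib diff_divide_distrib)
    also have "\<dots> \<le> 0"
      using total_rate_pos by (intro jlw_contracts_deviation[OF eq]) simp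
    finally show ?thesis by simp
  qed
  also have "Q * ?\<Lambda> + 2 * (\<Sum>j\<in>UNIV. w j * y j * ?d \<pi> j) + (\<Sum>j\<in>UNIV. w j * ?\<Lambda>) =
      (Q + 2 * (\<Sum>j\<in>UNIV. w j * y j * u j) + (\<Sum>j\<in>UNIV. w j)) * ?\<Lambda>"
    using total_rate_pos by (simp add: u_def distrib_right sum_distrib_right)
  also have "Q + 2 * (\<Sum>j\<in>UNIV. w j * y j * u j) = deviation \<pi> n x - (\<Sum>j\<in>UNIV. w j * (u j)\<^sup>2)"
    unfolding dev Q_def sum_distrib_left sum.distrib[symmetric] sum_subtractf[symmetric]
    by (intro sum.cong refl) (simp add: y_def power2_eq_square algebra_simps)
  also have "\<dots> + (\<Sum>j\<in>UNIV. w j) \<le> deviation \<pi> n x + (\<Sum>j\<in>UNIV. w j)"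
    using w_pos by (simp add: sum_nonneg less_imp_le)
  finally have "(\<Sum>j\<in>UNIV. arrival x j * deviation \<pi> (Suc n) (x + axis j 1) +
        mu j * deviation \<pi> (Suc n) (x - axis j 1)) / ?\<Lambda> \<le> deviation \<pi> n x + (\<Sum>j\<in>UNIV. w j)"
    using total_rate_pos by (simp add: pos_divide_le_eq mult_right_mono)
  then show ?thesis
    using w_pos dev_nonneg
    by (simp add: nn_integral_kernel ennreal_plus[symmetric] sum_nonneg less_imp_le ennreal_leI del: ennreal_plus)
qed

end

section \<open>Laws of a jump chain with exponential holding times\<close>

text \<open>
  Disintegration over a countable-valued random variable; it replaces conditional expectations in
  what follows.
\<close>
lemma nn_integral_split_countable:
  fixes Z :: "'w \<Rightarrow> 's::countable"
  assumes [measurable]: "F \<in> borel_measurable M" "Z \<in> measurable M (count_space UNIV)"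
  shows "(\<integral>\<^sup>+\<omega>. F \<omega> \<partial>M) =
    (\<integral>\<^sup>+a. \<integral>\<^sup>+\<omega>. F \<omega> * indicator {\<omega>\<in>space M. Z \<omega> = a} \<omega> \<partial>M \<partial>count_space UNIV)"
proof -
  have "(\<integral>\<^sup>+\<omega>. F \<omega> \<partial>M) =
      (\<integral>\<^sup>+\<omega>. \<integral>\<^sup>+a. F \<omega> * indicator {\<omega>\<in>space M. Z \<omega> = a} \<omega> \<partial>count_space UNIV \<partial>M)"
  proof (rule nn_integral_cong)
    fix \<omega> assume "\<omega> \<in> space M"
    then have "(\<integral>\<^sup>+a. F \<omega> * indicator {\<omega>\<in>space M. Z \<omega> = a} \<omega> \<partial>count_space UNIV) =
        (\<integral>\<^sup>+a. F \<omega> * indicator {Z \<omega>} a \<partial>count_space UNIV)"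
      by (intro nn_integral_cong) (simp split: split_indicator)
    then show "F \<omega> = (\<integral>\<^sup>+a. F \<omega> * indicator {\<omega>\<in>space M. Z \<omega> = a} \<omega> \<partial>count_space UNIV)"
      by (simp add: nn_integral_cmult_indicator)
  qed
  also have "\<dots> = (\<integral>\<^sup>+a. \<integral>\<^sup>+\<omega>. F \<omega> * indicator {\<omega>\<in>space M. Z \<omega> = a} \<omega> \<partial>M \<partial>count_space UNIV)"
    by (rule nn_integral_count_space_nn_integral) auto
  finally show ?thesis .
qed

lemma emeasure_split_countable:
  fixes Z :: "'w \<Rightarrow> 's::countable"
  assumes [measurable]: "Measurable.pred M P" "Z \<in> measurable M (count_space UNIV)"
  shows "emeasure M {\<omega>\<in>space M. P \<omega>} =
    (\<integral>\<^sup>+a. emeasure M {\<omega>\<in>space M. Z \<omega> = a \<and> P \<omega>} \<partial>count_space UNIV)"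
proof -
  have "emeasure M {\<omega>\<in>space M. P \<omega>} = (\<integral>\<^sup>+\<omega>. indicator {\<omega>\<in>space M. P \<omega>} \<omega> \<partial>M)"
    by simp
  also have "\<dots> = (\<integral>\<^sup>+a. \<integral>\<^sup>+\<omega>. indicator {\<omega>\<in>space M. P \<omega>} \<omega> *
      indicator {\<omega>\<in>space M. Z \<omega> = a} \<omega> \<partial>M \<partial>count_space UNIV)"
    by (rule nn_integral_split_countable) measurable
  also have "\<dots> = (\<integral>\<^sup>+a. \<integral>\<^sup>+\<omega>. indicator {\<omega>\<in>space M. Z \<omega> = a \<and> P \<omega>} \<omega> \<partial>M \<partial>count_space UNIV)"
    by (intro nn_integral_cong) (simp split: split_indicator)
  finally show ?thesis by simp
qed

locale uniform_jump_chain = prob_space M for M :: "'w measure" +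
  fixes Y :: "nat \<Rightarrow> 'w \<Rightarrow> 's::countable" and H :: "nat \<Rightarrow> 'w \<Rightarrow> real"
    and K :: "'s \<Rightarrow> 's pmf" and r :: real and x0 :: 's
  assumes r_pos: "r > 0"
    and Y_meas [measurable]: "\<And>n. Y n \<in> measurable M (count_space UNIV)"
    and H_meas [measurable]: "\<And>n. H n \<in> borel_measurable M"
    and joint: "\<And>n y s. \<forall>m<n. 0 \<le> s m \<Longrightarrow>
      prob {\<omega> \<in> space M. (\<forall>m\<le>n. Y m \<omega> = y m) \<and> (\<forall>m<n. s m < H m \<omega>)} =
        (if y 0 = x0 then 1 else 0) *
        (\<Prod>m<n. pmf (K (y m)) (y (Suc m)) * exp (- r * s m))"
begin

text \<open>
  The joint law prescribes probabilities of full histories. Summing over the histories of length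
  \<open>n\<close> before the states \<open>a\<close> and \<open>b\<close> turns it into a statement about one step.
\<close>
lemma markov_step:
  assumes s: "\<forall>m<Suc n. 0 \<le> s m"
  shows "emeasure M {\<omega>\<in>space M. Y n \<omega> = a \<and> Y (Suc n) \<omega> = b \<and> (\<forall>m<Suc n. s m < H m \<omega>)} =
    emeasure M {\<omega>\<in>space M. Y n \<omega> = a \<and> (\<forall>m<n. s m < H m \<omega>)} * ennreal (pmf (K a) b * exp (- r * s n))"
proof -
  define I where "I = {ys :: 's list. length ys = n}"
  define X where "X ys = {\<omega>\<in>space M. (\<forall>m\<le>n. Y m \<omega> = (ys @ [a,b]) ! m) \<and> (\<forall>m<n. s m < H m \<omega>)}" for ys
  define X' where "X' ys = {\<omega>\<in>space M. (\<forall>m\<le>Suc n. Y m \<omega> = (ys @ [a,b]) ! m) \<and> (\<forall>m<Suc n. s m < H m \<omega>)}" for ys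
  have hist: "map (\<lambda>m. Y m \<omega>) [0..<n] \<in> I" for \<omega> by (simp add: I_def)
  have same: "ys = zs" if "ys \<in> I" "zs \<in> I" "\<forall>m\<le>n. (ys @ [a,b]) ! m = (zs @ [a,b]) ! m" for ys zs
  proof (rule nth_equalityI)
    fix i assume "i < length ys"
    then show "ys ! i = zs ! i"
      using that by (auto simp: I_def nth_append dest!: spec[of _ i])
  qed (use that in \<open>simp add: I_def\<close>)
  have "disjoint_family_on X I" "disjoint_family_on X' I"
    unfolding disjoint_family_on_def X_def X'_def using same by (fastforce, fastforce)
  moreover have "{\<omega>\<in>space M. Y n \<omega> = a \<and> (\<forall>m<n. s m < H m \<omega>)} = (\<Union>ys\<in>I. X ys)" (is "?L = _")
  proof (intro set_eqI iffI)
    fix \<omega> assume "\<omega> \<in> ?L"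
    then have "\<omega> \<in> X (map (\<lambda>m. Y m \<omega>) [0..<n])"
      by (auto simp: X_def nth_append)
    then show "\<omega> \<in> (\<Union>ys\<in>I. X ys)" using hist by blast
  qed (auto simp: X_def I_def nth_append)
  moreover have "{\<omega>\<in>space M. Y n \<omega> = a \<and> Y (Suc n) \<omega> = b \<and> (\<forall>m<Suc n. s m < H m \<omega>)} =
      (\<Union>ys\<in>I. X' ys)" (is "?L' = _")
  proof (intro set_eqI iffI)
    fix \<omega> assume "\<omega> \<in> ?L'"
    then have "\<omega> \<in> X' (map (\<lambda>m. Y m \<omega>) [0..<n])"
      by (auto simp: X'_def nth_append nth_Cons' le_Suc_eq)
    then show "\<omega> \<in> (\<Union>ys\<in>I. X' ys)" using hist by blast
  qed (auto simp: X'_def I_def nth_append)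
  moreover have "X ys \<in> sets M" "X' ys \<in> sets M" for ys
    unfolding X_def X'_def by measurable
  moreover have "emeasure M (X' ys) = emeasure M (X ys) * ennreal (pmf (K a) b * exp (- r * s n))"
    if "ys \<in> I" for ys
  proof -
    have "prob (X' ys) = prob (X ys) * (pmf (K a) b * exp (- r * s n))"
      unfolding X_def X'_def using s that
      by (subst (1 2) joint) (auto simp: I_def nth_append)
    then show ?thesis
      by (simp add: emeasure_eq_measure ennreal_mult)
  qed
  ultimately show ?thesis
    by (simp add: emeasure_UN_countable nn_integral_multc cong: nn_integral_cong_simp)
qed

lemma holding_tail_step:
  assumes s: "\<forall>m<Suc n. 0 \<le> s m"
  shows "emeasure M {\<omega>\<in>space M. \<forall>m<Suc n. s m < H m \<omega>} =
    emeasure M {\<omega>\<in>space M. \<forall>m<n. s m < H m \<omega>} * ennreal (exp (- r * s n))"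
proof -
  let ?B = "\<lambda>n \<omega>. \<forall>m<n. s m < H m \<omega>"
  have 1: "emeasure M {\<omega>\<in>space M. Y n \<omega> = a \<and> ?B (Suc n) \<omega>} =
      emeasure M {\<omega>\<in>space M. Y n \<omega> = a \<and> ?B n \<omega>} * ennreal (exp (- r * s n))" for a
  proof -
    have "emeasure M {\<omega>\<in>space M. Y n \<omega> = a \<and> ?B (Suc n) \<omega>} =
        (\<integral>\<^sup>+b. emeasure M {\<omega>\<in>space M. Y (Suc n) \<omega> = b \<and> Y n \<omega> = a \<and> ?B (Suc n) \<omega>} \<partial>count_space UNIV)"
      by (rule emeasure_split_countable) measurable
    also have "\<dots> = (\<integral>\<^sup>+b. emeasure M {\<omega>\<in>space M. Y n \<omega> = a \<and> ?B n \<omega>} * ennreal (exp (- r * s n)) *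
        ennreal (pmf (K a) b) \<partial>count_space UNIV)"
    proof (rule nn_integral_cong)
      fix b
      have "{\<omega>\<in>space M. Y (Suc n) \<omega> = b \<and> Y n \<omega> = a \<and> ?B (Suc n) \<omega>} =
          {\<omega>\<in>space M. Y n \<omega> = a \<and> Y (Suc n) \<omega> = b \<and> ?B (Suc n) \<omega>}" by blast
      then show "emeasure M {\<omega>\<in>space M. Y (Suc n) \<omega> = b \<and> Y n \<omega> = a \<and> ?B (Suc n) \<omega>} =
          emeasure M {\<omega>\<in>space M. Y n \<omega> = a \<and> ?B n \<omega>} * ennreal (exp (- r * s n)) * ennreal (pmf (K a) b)"
        by (simp only: markov_step[OF s]) (simp add: ennreal_mult mult_ac)
    qed
    also have "\<dots> = emeasure M {\<omega>\<in>space M. Y n \<omega> = a \<and> ?B n \<omega>} * ennreal (exp (- r * s n)) * 1"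
      by (subst nn_integral_cmult) (auto simp: nn_integral_pmf measure_pmf.emeasure_space_1[simplified])
    finally show ?thesis by simp
  qed
  have "emeasure M {\<omega>\<in>space M. ?B (Suc n) \<omega>} =
      (\<integral>\<^sup>+a. emeasure M {\<omega>\<in>space M. Y n \<omega> = a \<and> ?B (Suc n) \<omega>} \<partial>count_space UNIV)"
    by (rule emeasure_split_countable) measurable
  also have "\<dots> = (\<integral>\<^sup>+a. emeasure M {\<omega>\<in>space M. Y n \<omega> = a \<and> ?B n \<omega>} \<partial>count_space UNIV) *
      ennreal (exp (- r * s n))"
    unfolding 1 by (rule nn_integral_multc) simp
  also have "(\<integral>\<^sup>+a. emeasure M {\<omega>\<in>space M. Y n \<omega> = a \<and> ?B n \<omega>} \<partial>count_space UNIV) =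
      emeasure M {\<omega>\<in>space M. ?B n \<omega>}"
    by (rule emeasure_split_countable[symmetric]) measurable
  finally show ?thesis .
qed

lemma holding_tail:
  assumes "\<forall>m<n. 0 \<le> s m"
  shows "prob {\<omega>\<in>space M. \<forall>m<n. s m < H m \<omega>} = (\<Prod>m<n. exp (- r * s m))"
  using assms
proof (induction n)
  case 0
  then show ?case by (simp add: prob_space)
next
  case (Suc n)
  then have "ennreal (prob {\<omega>\<in>space M. \<forall>m<Suc n. s m < H m \<omega>}) =
      ennreal ((\<Prod>m<n. exp (- r * s m)) * exp (- r * s n))"
    using holding_tail_step[OF Suc.prems] by (simp add: emeasure_eq_measure ennreal_mult prod_nonneg)
  then show ?case by (simp add: prod_nonneg)
qed

lemma holding_positive: "AE \<omega> in M. \<forall>m. 0 < H m \<omega>"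
proof -
  have "AE \<omega> in M. 0 < H n \<omega>" for n
    by (rule AE_prob_1[of "{\<omega>\<in>space M. \<forall>m<Suc n. 0 < H m \<omega>}", THEN AE_mp])
       (use holding_tail[of "Suc n" "\<lambda>_. 0"] in auto)
  then show ?thesis by (simp add: AE_all_countable)
qed

text \<open>
  The truncation \<open>max 0\<close> is needed because the thresholds range over all reals, as required for the
  generator of the Borel sets used for independence.
\<close>
lemma holding_tail_subset:
  assumes J: "finite J"
  shows "prob {\<omega>\<in>space M. \<forall>m\<in>J. s m < H m \<omega>} = (\<Prod>m\<in>J. exp (- r * max 0 (s m)))"
proof -
  obtain n where n: "J \<subseteq> {..<n}" using finite_nat_iff_bounded[THEN iffD1, OF J] by blast
  define s' where "s' m = (if m \<in> J then max 0 (s m) else 0)" for m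
  have "prob {\<omega>\<in>space M. \<forall>m\<in>J. s m < H m \<omega>} = prob {\<omega>\<in>space M. \<forall>m<n. s' m < H m \<omega>}"
  proof (rule finite_measure_eq_AE)
    show "AE \<omega> in M. (\<omega> \<in> {\<omega>\<in>space M. \<forall>m\<in>J. s m < H m \<omega>}) = (\<omega> \<in> {\<omega>\<in>space M. \<forall>m<n. s' m < H m \<omega>})"
      using holding_positive by eventually_elim (use n in \<open>auto simp: s'_def\<close>)
    show "{\<omega>\<in>space M. \<forall>m\<in>J. s m < H m \<omega>} \<in> events" using J by measurable
  qed measurable
  also have "\<dots> = (\<Prod>m<n. exp (- r * s' m))"
    by (rule holding_tail) (simp add: s'_def)
  also have "\<dots> = (\<Prod>m\<in>J. exp (- r * max 0 (s m)))"
    using n by (intro prod.mono_neutral_cong_right) (auto simp: s'_def)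
  finally show ?thesis .
qed

lemma holding_exponential: "distributed M lborel (H m) (exponential_density r)"
proof (rule exponential_distributedI)
  fix a :: real assume a: "0 \<le> a"
  have "prob {\<omega>\<in>space M. H m \<omega> \<le> a} = 1 - prob {\<omega>\<in>space M. \<forall>i\<in>{m}. a < H i \<omega>}"
    by (subst prob_neg[symmetric]) (auto simp: not_less)
  also have "\<dots> = 1 - exp (- a * r)"
    using a by (subst holding_tail_subset) (auto simp: mult_ac)
  finally show "emeasure M {\<omega>\<in>space M. H m \<omega> \<le> a} = 1 - ennreal (exp (- a * r))"
    by (simp add: emeasure_eq_measure ennreal_minus ennreal_1[symmetric] del: ennreal_1)
qed (use r_pos in auto)

lemma holding_independent: "indep_vars (\<lambda>_. borel) H UNIV"
proof -
  define E where "E m = {H m -` A \<inter> space M | A. A \<in> range (\<lambda>a. {a<..})}" for m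
  have Eev: "E m \<subseteq> events" for m
    by (auto simp: E_def)
  have "indep_sets E UNIV"
  proof (rule indep_setsI[OF Eev])
    fix A and J :: "nat set" assume J: "J \<noteq> {}" "finite J" and A: "\<forall>j\<in>J. A j \<in> E j"
    then have "\<forall>j\<in>J. \<exists>a. A j = {\<omega>\<in>space M. a < H j \<omega>}"
      by (fastforce simp: E_def)
    then obtain a where a: "\<And>j. j \<in> J \<Longrightarrow> A j = {\<omega>\<in>space M. a j < H j \<omega>}" by metis
    then have "(\<Inter>j\<in>J. A j) = {\<omega>\<in>space M. \<forall>m\<in>J. a m < H m \<omega>}"
      using J by auto
    then have "prob (\<Inter>j\<in>J. A j) = (\<Prod>m\<in>J. exp (- r * max 0 (a m)))"
      using holding_tail_subset[OF J(2)] by simp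
    also have "\<dots> = (\<Prod>j\<in>J. prob (A j))"
    proof (rule prod.cong)
      fix j assume "j \<in> J"
      then show "exp (- r * max 0 (a j)) = prob (A j)"
        using holding_tail_subset[of "{j}" a] a by simp
    qed simp
    finally show "prob (\<Inter>j\<in>J. A j) = (\<Prod>j\<in>J. prob (A j))" .
  qed
  moreover have "Int_stable (E m)" for m
  proof (rule Int_stableI)
    fix A B assume "A \<in> E m" "B \<in> E m"
    then obtain a b where "A = H m -` {a<..} \<inter> space M" "B = H m -` {b<..} \<inter> space M"
      by (auto simp: E_def)
    then have "A \<inter> B = H m -` {max a b<..} \<inter> space M" by auto
    then show "A \<inter> B \<in> E m" by (auto simp: E_def)
  qed
  ultimately have "indep_sets (\<lambda>m. sigma_sets (space M) (E m)) UNIV"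
    by (rule indep_sets_sigma)
  moreover have "sigma_sets (space M) (E m) = {H m -` A \<inter> space M | A. A \<in> sets borel}" for m
  proof -
    have "sigma_sets (space M) (E m) =
        {H m -` A \<inter> space M | A. A \<in> sigma_sets UNIV (range (\<lambda>a. {a<..}))}"
      unfolding E_def by (rule sigma_sets_vimage_commute[symmetric]) auto
    also have "sigma_sets UNIV (range (\<lambda>a. {a<..})) = sets (borel :: real measure)"
      by (simp add: borel_Ioi)
    finally show ?thesis .
  qed
  ultimately show ?thesis
    unfolding indep_vars_def2 by simp
qed

text \<open>
  The jump time is a sum of independent exponential variables, hence Erlang distributed.
\<close>
lemma jump_time_variance:
  "(\<integral>\<^sup>+\<omega>. ennreal (((\<Sum>m<n. H m \<omega>) - n / r)\<^sup>2) \<partial>M) = ennreal (n / r\<^sup>2)"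
proof (cases "n = 0")
  case False
  let ?T = "\<lambda>\<omega>. \<Sum>m<n. H m \<omega>"
  have "indep_vars (\<lambda>_. borel) H {..<n}"
    using holding_independent by (rule indep_vars_subset) simp
  moreover have "{..<n} \<noteq> {}" using False by auto
  ultimately have er: "distributed M lborel ?T (erlang_density (n - 1) r)"
    using exponential_distributed_sum[of "{..<n}" r H] r_pos holding_exponential by simp
  have ex: "expectation ?T = n / r"
    using erlang_ith_moment[OF r_pos er, of 1] False r_pos by (simp add: fact_reduce)
  have "integrable M ?T" "integrable M (\<lambda>\<omega>. (?T \<omega>)\<^sup>2)"
    using erlang_ith_moment_integrable[OF r_pos er, of 1] erlang_ith_moment_integrable[OF r_pos er, of 2] by auto
  then have "integrable M (\<lambda>\<omega>. (?T \<omega> - n / r)\<^sup>2)"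
    by (simp add: power2_diff)
  then have "(\<integral>\<^sup>+\<omega>. ennreal ((?T \<omega> - n / r)\<^sup>2) \<partial>M) = ennreal (variance ?T)"
    unfolding ex by (intro nn_integral_eq_integral) auto
  then show ?thesis
    using erlang_distributed_variance[OF r_pos er] False by simp
qed simp

lemma jump_pair:
  "emeasure M {\<omega>\<in>space M. Y n \<omega> = a \<and> Y (Suc n) \<omega> = b} =
    emeasure M {\<omega>\<in>space M. Y n \<omega> = a} * ennreal (pmf (K a) b)"
proof -
  have "emeasure M {\<omega>\<in>space M. Y n \<omega> = a \<and> Y (Suc n) \<omega> = b} =
      emeasure M {\<omega>\<in>space M. Y n \<omega> = a \<and> Y (Suc n) \<omega> = b \<and> (\<forall>m<Suc n. 0 < H m \<omega>)}"
    by (rule emeasure_eq_AE) (use holding_positive in auto)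
  also have "\<dots> = emeasure M {\<omega>\<in>space M. Y n \<omega> = a \<and> (\<forall>m<n. 0 < H m \<omega>)} * ennreal (pmf (K a) b)"
    using markov_step[of n "\<lambda>_. 0" a b] by simp
  also have "emeasure M {\<omega>\<in>space M. Y n \<omega> = a \<and> (\<forall>m<n. 0 < H m \<omega>)} =
      emeasure M {\<omega>\<in>space M. Y n \<omega> = a}"
    by (rule emeasure_eq_AE) (use holding_positive in auto)
  finally show ?thesis .
qed

text \<open>
  The Markov property in the form in which the Lyapunov estimate is applied.
\<close>
lemma nn_integral_jump:
  "(\<integral>\<^sup>+\<omega>. g (Y (Suc n) \<omega>) \<partial>M) = (\<integral>\<^sup>+\<omega>. (\<integral>\<^sup>+y. g y \<partial>K (Y n \<omega>)) \<partial>M)"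
proof -
  let ?A = "\<lambda>a. {\<omega>\<in>space M. Y n \<omega> = a}" and ?B = "\<lambda>b. {\<omega>\<in>space M. Y (Suc n) \<omega> = b}"
  have "(\<integral>\<^sup>+\<omega>. g (Y (Suc n) \<omega>) \<partial>M) =
      (\<integral>\<^sup>+a. \<integral>\<^sup>+\<omega>. g (Y (Suc n) \<omega>) * indicator (?A a) \<omega> \<partial>M \<partial>count_space UNIV)"
    by (rule nn_integral_split_countable) measurable
  also have "\<dots> = (\<integral>\<^sup>+a. emeasure M (?A a) * (\<integral>\<^sup>+y. g y \<partial>K a) \<partial>count_space UNIV)"
  proof (rule nn_integral_cong)
    fix a
    have "(\<integral>\<^sup>+\<omega>. g (Y (Suc n) \<omega>) * indicator (?A a) \<omega> \<partial>M) =
        (\<integral>\<^sup>+b. \<integral>\<^sup>+\<omega>. g (Y (Suc n) \<omega>) * indicator (?A a) \<omega> * indicator (?B b) \<omega> \<partial>M \<partial>count_space UNIV)"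
      by (rule nn_integral_split_countable) measurable
    also have "\<dots> = (\<integral>\<^sup>+b. \<integral>\<^sup>+\<omega>. g b * indicator {\<omega>\<in>space M. Y n \<omega> = a \<and> Y (Suc n) \<omega> = b} \<omega> \<partial>M \<partial>count_space UNIV)"
      by (intro nn_integral_cong) (simp split: split_indicator)
    also have "\<dots> = (\<integral>\<^sup>+b. emeasure M (?A a) * (ennreal (pmf (K a) b) * g b) \<partial>count_space UNIV)"
      by (simp add: nn_integral_cmult_indicator jump_pair mult_ac)
    also have "\<dots> = emeasure M (?A a) * (\<integral>\<^sup>+y. g y \<partial>K a)"
      by (simp add: nn_integral_cmult nn_integral_measure_pmf)
    finally show "(\<integral>\<^sup>+\<omega>. g (Y (Suc n) \<omega>) * indicator (?A a) \<omega> \<partial>M) =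
        emeasure M (?A a) * (\<integral>\<^sup>+y. g y \<partial>K a)" .
  qed
  also have "\<dots> = (\<integral>\<^sup>+a. \<integral>\<^sup>+\<omega>. (\<integral>\<^sup>+y. g y \<partial>K (Y n \<omega>)) * indicator (?A a) \<omega> \<partial>M \<partial>count_space UNIV)"
  proof (rule nn_integral_cong)
    fix a
    have "(\<integral>\<^sup>+\<omega>. (\<integral>\<^sup>+y. g y \<partial>K (Y n \<omega>)) * indicator (?A a) \<omega> \<partial>M) =
        (\<integral>\<^sup>+\<omega>. (\<integral>\<^sup>+y. g y \<partial>K a) * indicator (?A a) \<omega> \<partial>M)"
      by (intro nn_integral_cong) (simp split: split_indicator)
    then show "emeasure M (?A a) * (\<integral>\<^sup>+y. g y \<partial>K a) =
        (\<integral>\<^sup>+\<omega>. (\<integral>\<^sup>+y. g y \<partial>K (Y n \<omega>)) * indicator (?A a) \<omega> \<partial>M)"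
      by (simp add: nn_integral_cmult_indicator mult_ac)
  qed
  also have "\<dots> = (\<integral>\<^sup>+\<omega>. (\<integral>\<^sup>+y. g y \<partial>K (Y n \<omega>)) \<partial>M)"
    by (rule nn_integral_split_countable[symmetric]) measurable
  finally show ?thesis .
qed

lemma chain_starts_at_x0: "AE \<omega> in M. Y 0 \<omega> = x0"
  by (rule AE_prob_1[of "{\<omega>\<in>space M. Y 0 \<omega> = x0}", THEN AE_mp])
     (use joint[of 0 "\<lambda>_. 0" "\<lambda>_. x0"] in auto)

lemma jumps_in_support: "AE \<omega> in M. \<forall>n. Y (Suc n) \<omega> \<in> set_pmf (K (Y n \<omega>))"
proof -
  have "AE \<omega> in M. \<not> (Y n \<omega> = a \<and> Y (Suc n) \<omega> = b \<and> b \<notin> set_pmf (K a))" for n a b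
  proof (cases "b \<in> set_pmf (K a)")
    case False
    then have "emeasure M {\<omega>\<in>space M. Y n \<omega> = a \<and> Y (Suc n) \<omega> = b} = 0"
      by (simp add: jump_pair set_pmf_iff)
    then show ?thesis
      by (intro AE_I'[of "{\<omega>\<in>space M. Y n \<omega> = a \<and> Y (Suc n) \<omega> = b}"]) auto
  qed simp
  then have "AE \<omega> in M. \<forall>n a b. \<not> (Y n \<omega> = a \<and> Y (Suc n) \<omega> = b \<and> b \<notin> set_pmf (K a))"
    by (intro AE_all_countable[THEN iffD2] allI)
  then show ?thesis by (rule AE_mp) auto
qed

end

section \<open>From variance bounds to almost sure rates\<close>

text \<open>
  Along \<open>n = m^4\<close> the second moments divided by \<open>m^6\<close> are of order \<open>m^(-2)\<close>, so their sum is finite,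
  and almost surely so is the sum of the squares divided by \<open>m^6\<close>. The fourth power is chosen because
  \<open>n^(3/4)\<close> is then the integer power \<open>m^3\<close>, which is also the order of the gap to the next
  fourth power.
\<close>
lemma (in prob_space) quartic_subsequence_bound:
  fixes Z :: "nat \<Rightarrow> 'a \<Rightarrow> real"
  assumes [measurable]: "\<And>n. Z n \<in> borel_measurable M" and c: "0 \<le> c"
    and var: "\<And>n. (\<integral>\<^sup>+\<omega>. ennreal ((Z n \<omega>)\<^sup>2) \<partial>M) \<le> ennreal (c * real (Suc n))"
  shows "AE \<omega> in M. \<exists>B. \<forall>m. \<bar>Z (m ^ 4) \<omega>\<bar> \<le> B * real (Suc m) ^ 3"
proof -
  define F where "F m \<omega> = ennreal ((Z (m ^ 4) \<omega>)\<^sup>2 / real (Suc m) ^ 6)" for m \<omega>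
  have F_meas [measurable]: "F m \<in> borel_measurable M" for m
    unfolding F_def by measurable
  have F_bound: "(\<integral>\<^sup>+\<omega>. F m \<omega> \<partial>M) \<le> ennreal (c * inverse (real (Suc m) ^ 2))" for m
  proof -
    have "(\<integral>\<^sup>+\<omega>. F m \<omega> \<partial>M) =
        (\<integral>\<^sup>+\<omega>. ennreal (1 / real (Suc m) ^ 6) * ennreal ((Z (m ^ 4) \<omega>)\<^sup>2) \<partial>M)"
      unfolding F_def by (intro nn_integral_cong) (simp flip: ennreal_mult)
    also have "\<dots> = ennreal (1 / real (Suc m) ^ 6) * (\<integral>\<^sup>+\<omega>. ennreal ((Z (m ^ 4) \<omega>)\<^sup>2) \<partial>M)"
      by (rule nn_integral_cmult) measurable
    also have "\<dots> \<le> ennreal (1 / real (Suc m) ^ 6) * ennreal (c * real (Suc (m ^ 4)))"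
      by (intro mult_left_mono var) simp
    also have "\<dots> = ennreal (1 / real (Suc m) ^ 6 * (c * real (Suc (m ^ 4))))"
      using c by (simp flip: ennreal_mult)
    also have "\<dots> \<le> ennreal (c * inverse (real (Suc m) ^ 2))"
    proof (rule ennreal_leI)
      have "Suc (m ^ 4) \<le> Suc m ^ 4"
        using power_strict_mono[of m "Suc m" 4] by simp
      then have "real (Suc (m ^ 4)) \<le> real (Suc m) ^ 4"
        by (metis of_nat_le_iff of_nat_power)
      then have "1 / real (Suc m) ^ 6 * (c * real (Suc (m ^ 4))) \<le> 1 / real (Suc m) ^ 6 * (c * real (Suc m) ^ 4)"
        using c by (intro mult_left_mono) auto
      also have "\<dots> = c * (real (Suc m) ^ 4 / (real (Suc m) ^ 4 * real (Suc m) ^ 2))"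
        by (simp flip: power_add)
      also have "\<dots> = c * inverse (real (Suc m) ^ 2)"
        by (simp add: field_simps del: of_nat_Suc)
      finally show "1 / real (Suc m) ^ 6 * (c * real (Suc (m ^ 4))) \<le> c * inverse (real (Suc m) ^ 2)" .
    qed
    finally show ?thesis .
  qed
  have "summable (\<lambda>m. inverse (real (Suc m) ^ 2))"
    using inverse_power_summable[of 2, where 'a = real] by (subst summable_Suc_iff) simp
  then have sm: "summable (\<lambda>m. c * inverse (real (Suc m) ^ 2))"
    by (rule summable_mult)
  have "(\<integral>\<^sup>+\<omega>. (\<Sum>m. F m \<omega>) \<partial>M) = (\<Sum>m. \<integral>\<^sup>+\<omega>. F m \<omega> \<partial>M)"
    by (rule nn_integral_suminf) measurable
  also have "\<dots> \<le> (\<Sum>m. ennreal (c * inverse (real (Suc m) ^ 2)))"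
    by (intro suminf_le F_bound) auto
  also have "\<dots> = ennreal (\<Sum>m. c * inverse (real (Suc m) ^ 2))"
    using c by (intro suminf_ennreal2 sm) auto
  finally have "(\<integral>\<^sup>+\<omega>. (\<Sum>m. F m \<omega>) \<partial>M) \<noteq> \<infinity>"
    by (auto simp: top_unique)
  then have "AE \<omega> in M. (\<Sum>m. F m \<omega>) \<noteq> \<infinity>"
    by (intro nn_integral_PInf_AE) measurable
  then show ?thesis
  proof eventually_elim
    fix \<omega> assume fin: "(\<Sum>m. F m \<omega>) \<noteq> \<infinity>"
    then obtain b where b: "0 \<le> b" "(\<Sum>m. F m \<omega>) = ennreal b"
      by (cases "\<Sum>m. F m \<omega>") auto
    have "\<bar>Z (m ^ 4) \<omega>\<bar> \<le> sqrt b * real (Suc m) ^ 3" for m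
    proof -
      have "F m \<omega> \<le> (\<Sum>m. F m \<omega>)"
        using sum_le_suminf[of "\<lambda>m. F m \<omega>" "{m}"] by simp
      then have "(Z (m ^ 4) \<omega>)\<^sup>2 / real (Suc m) ^ 6 \<le> b"
        using b by (simp add: F_def)
      then have "(Z (m ^ 4) \<omega>)\<^sup>2 \<le> b * real (Suc m) ^ 6"
        by (simp add: pos_divide_le_eq del: of_nat_Suc)
      also have "\<dots> = (sqrt b * real (Suc m) ^ 3)\<^sup>2"
        using b by (simp add: power_mult_distrib flip: power_mult)
      finally have sq: "(Z (m ^ 4) \<omega>)\<^sup>2 \<le> (sqrt b * real (Suc m) ^ 3)\<^sup>2" .
      have "0 \<le> sqrt b * real (Suc m) ^ 3"
        by (intro mult_nonneg_nonneg real_sqrt_ge_zero b zero_le_power of_nat_0_le_iff)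
      with sq show ?thesis by (metis abs_le_square_iff abs_of_nonneg)
    qed
    then show "\<exists>B. \<forall>m. \<bar>Z (m ^ 4) \<omega>\<bar> \<le> B * real (Suc m) ^ 3" by blast
  qed
qed

text \<open>
  Between \<open>m^4\<close> and \<open>(m+1)^4\<close> the sequence is bounded below by its value at the left end and above by
  its value at the right end, up to \<open>c\<close> times the gap. Only a bound on downward steps is assumed, so
  the lemma applies to centred jump times, whose upward steps are unbounded.
\<close>
lemma one_sided_increments_interpolate:
  fixes f :: "nat \<Rightarrow> real"
  assumes incr: "\<And>n. f n - c \<le> f (Suc n)" and c: "0 \<le> c"
    and sub: "\<And>m. \<bar>f (m ^ 4)\<bar> \<le> B * real (Suc m) ^ 3"
  shows "\<exists>C. \<forall>n. \<bar>f n\<bar> \<le> C * real (Suc n) powr (3/4)"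
proof -
  have drop: "f n - c * real k \<le> f (n + k)" for n k
  proof (induction k)
    case (Suc k)
    then show ?case using incr[of "n + k"] by (simp add: algebra_simps)
  qed simp
  have B: "0 \<le> B" using sub[of 0] by simp
  have "\<bar>f n\<bar> \<le> 8 * (8 * B + 4 * c) * real (Suc n) powr (3/4)" for n
  proof -
    have "n < Suc n ^ 4" using self_le_power[of "Suc n" 4] by simp
    from ex_least_nat_less[of "\<lambda>k. n < k ^ 4", OF this]
    obtain m where "\<forall>i\<le>m. \<not> n < i ^ 4" and up: "n < Suc m ^ 4" by auto
    then have lo: "m ^ 4 \<le> n" by auto
    define x where "x = real (Suc m)"
    have x: "1 \<le> x" by (simp add: x_def)
    have "real (Suc m) ^ 4 - real m ^ 4 \<le> 4 * real (Suc m) ^ 3"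
      by (simp add: power_Suc numeral_eq_Suc algebra_simps)
    then have gap: "real (Suc m ^ 4) - real (m ^ 4) \<le> 4 * x ^ 3"
      by (simp add: x_def)
    have "c * (real (Suc m ^ 4) - real (m ^ 4)) \<le> c * (4 * x ^ 3)"
      using gap c by (rule mult_left_mono)
    moreover have "c * (real n - real (m ^ 4)) \<le> c * (real (Suc m ^ 4) - real (m ^ 4))"
      using up c by (intro mult_left_mono) (auto simp del: of_nat_power)
    moreover have "c * (real (Suc m ^ 4) - real n) \<le> c * (real (Suc m ^ 4) - real (m ^ 4))"
      using lo c by (intro mult_left_mono) (auto simp del: of_nat_power)
    moreover have "f (m ^ 4) - c * (real n - real (m ^ 4)) \<le> f n"
      using drop[of "m ^ 4" "n - m ^ 4"] lo by (simp add: of_nat_diff)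
    moreover have "f n - c * (real (Suc m ^ 4) - real n) \<le> f (Suc m ^ 4)"
      using drop[of n "Suc m ^ 4 - n"] up by (simp add: of_nat_diff)
    moreover have "\<bar>f (m ^ 4)\<bar> \<le> 8 * B * x ^ 3"
    proof -
      have "0 \<le> B * x ^ 3" using B x by simp
      then show ?thesis using sub[of m] by (simp add: x_def)
    qed
    moreover have "\<bar>f (Suc m ^ 4)\<bar> \<le> 8 * B * x ^ 3"
    proof -
      have "real (Suc (Suc m)) \<le> 2 * x" by (simp add: x_def)
      then have "real (Suc (Suc m)) ^ 3 \<le> (2 * x) ^ 3" by (rule power_mono) simp
      then have "B * real (Suc (Suc m)) ^ 3 \<le> B * (2 * x) ^ 3" using B by (rule mult_left_mono)
      then show ?thesis using sub[of "Suc m"] by (simp add: power_mult_distrib)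
    qed
    ultimately have fn: "\<bar>f n\<bar> \<le> (8 * B + 4 * c) * x ^ 3"
      by (simp add: abs_le_iff algebra_simps)
    have "x ^ 3 \<le> 8 * real (Suc n) powr (3/4)"
    proof -
      define y where "y = real (Suc n) powr (1/4)"
      have y1: "1 \<le> y" unfolding y_def by (rule ge_one_powr_ge_zero) auto
      have "y ^ 4 = real (Suc n)" by (simp add: y_def powr_power)
      moreover have "real m ^ 4 \<le> real n" using lo by (metis of_nat_le_iff of_nat_power)
      ultimately have "real m ^ 4 \<le> y ^ 4" by linarith
      then have "real m \<le> y" using y1 by (auto intro: power_le_imp_le_base[where n = 3])
      then have "x ^ 3 \<le> (2 * y) ^ 3" using y1 by (intro power_mono) (auto simp: x_def)
      also have "\<dots> = 8 * real (Suc n) powr (3/4)"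
        by (simp add: y_def powr_power power_mult_distrib)
      finally show ?thesis .
    qed
    then have "(8 * B + 4 * c) * x ^ 3 \<le> (8 * B + 4 * c) * (8 * real (Suc n) powr (3/4))"
      using B c by (intro mult_left_mono) auto
    with fn show ?thesis by (simp only: mult_ac)
  qed
  then show ?thesis by blast
qed

text \<open>
  If the \<open>n\<close>-th jump time \<open>s\<close> is close to \<open>n / r\<close> then at most of order \<open>t\<close> jumps happen before \<open>t\<close>. The
  constant \<open>D\<close> depends on \<open>r\<close> and \<open>N\<close> only, which is what makes the later threshold time deterministic.
\<close>
lemma jump_count_linear:
  fixes r N :: real
  assumes r: "0 < r" and N: "0 \<le> N"
  shows "\<exists>D\<ge>0. \<forall>t\<ge>1. \<forall>n s. \<bar>s - real n / r\<bar> \<le> N * real (Suc n) powr (3/4) \<longrightarrow> s \<le> t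
    \<longrightarrow> real (Suc n) \<le> D * t"
proof (intro exI conjI allI impI)
  \<comment> \<open>Either the fluctuation term is at most half of \<open>Suc n\<close>, or \<open>Suc n\<close> is below the fourth power of \<open>2 * r * N\<close>.\<close>
  let ?D = "2 * (1 + r) + (2 * r * N) ^ 4"
  show "0 \<le> ?D" using r by simp
  fix t s :: real and n :: nat
  assume t: "1 \<le> t" and s: "\<bar>s - real n / r\<bar> \<le> N * real (Suc n) powr (3/4)" "s \<le> t"
  define x where "x = real (Suc n) powr (1/4)"
  have x: "1 \<le> x" unfolding x_def by (rule ge_one_powr_ge_zero) auto
  have x4: "real (Suc n) = x ^ 4" and x3: "real (Suc n) powr (3/4) = x ^ 3"
    by (simp_all add: x_def powr_power)
  have "real n / r \<le> t + N * x ^ 3" using s unfolding x3 abs_le_iff by linarith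
  then have "real n \<le> r * (t + N * x ^ 3)" using r by (simp add: pos_divide_le_eq mult.commute)
  then have ub: "x ^ 4 \<le> 1 + r * t + r * N * x ^ 3" using x4 by (simp add: algebra_simps)
  show "real (Suc n) \<le> ?D * t"
  proof (cases "2 * r * N \<le> x")
    case True
    then have "2 * r * N * x ^ 3 \<le> x * x ^ 3" using x by (intro mult_right_mono) auto
    then have "r * N * x ^ 3 \<le> x ^ 4 / 2" by (simp add: power_Suc[symmetric] del: power_Suc)
    then have "1 + r * t + r * N * x ^ 3 \<le> 1 + r * t + x ^ 4 / 2" by (rule add_left_mono)
    with ub have "x ^ 4 \<le> 1 + r * t + x ^ 4 / 2" by (rule order_trans)
    then have "x ^ 4 \<le> 2 * (1 + r * t)" by (simp add: field_simps)
    also have "\<dots> \<le> 2 * (1 + r) * t" using t by (simp add: algebra_simps)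
    also have "\<dots> \<le> ?D * t" using t by (intro mult_right_mono) auto
    finally show ?thesis using x4 by simp
  next
    case False
    then have "x ^ 4 \<le> (2 * r * N) ^ 4" using x by (intro power_mono) auto
    also have "\<dots> \<le> ?D" using r by simp
    also have "\<dots> \<le> ?D * t" using t mult_left_mono[of 1 t ?D] r by simp
    finally show ?thesis using x4 by simp
  qed
qed

text \<open>
  Here \<open>s\<close> and \<open>s'\<close> stand for consecutive jump times around \<open>t\<close>, and \<open>a\<close> for a weighted queue length
  between them. The exponent loses the factor between \<open>t^(3/4)\<close> and \<open>t\<close>, hence the bound \<open>1/4\<close>.
\<close>
lemma time_change_rate:
  fixes r N v \<epsilon> :: real
  assumes r: "0 < r" and N: "0 \<le> N" and \<epsilon>: "\<epsilon> < 1/4"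
  shows "\<forall>\<^sub>F t in at_top. \<forall>n a s s'.
    \<bar>s - real n / r\<bar> \<le> N * real (Suc n) powr (3/4) \<longrightarrow>
    \<bar>s' - real (Suc n) / r\<bar> \<le> N * real (Suc (Suc n)) powr (3/4) \<longrightarrow>
    \<bar>a - real n * v / r\<bar> \<le> N * real (Suc n) powr (3/4) \<longrightarrow>
    s \<le> t \<longrightarrow> t < s' \<longrightarrow> \<bar>a / t - v\<bar> < t powr (- \<epsilon>)"
proof -
  obtain D where D: "D \<ge> 0" and
    lin: "\<And>t n s. 1 \<le> t \<Longrightarrow> \<bar>s - real n / r\<bar> \<le> N * real (Suc n) powr (3/4) \<Longrightarrow> s \<le> t
      \<Longrightarrow> real (Suc n) \<le> D * t"
    using jump_count_linear[OF r N] by blast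
  define E where "E = (N + \<bar>v\<bar> * (2 * N + 1 / r)) * D powr (3/4)"
  have "\<forall>\<^sub>F t in at_top. E < t powr (1/4 - \<epsilon>)"
    using eventually_gt_at_top[of "(\<bar>E\<bar> + 1) powr (1 / (1/4 - \<epsilon>))"]
  proof eventually_elim
    fix t :: real assume "(\<bar>E\<bar> + 1) powr (1 / (1/4 - \<epsilon>)) < t"
    then have "((\<bar>E\<bar> + 1) powr (1 / (1/4 - \<epsilon>))) powr (1/4 - \<epsilon>) < t powr (1/4 - \<epsilon>)"
      using \<epsilon> by (intro powr_less_mono2) auto
    then show "E < t powr (1/4 - \<epsilon>)" using \<epsilon> by (simp add: powr_powr)
  qed
  moreover have "\<forall>\<^sub>F t in at_top. (1::real) \<le> t" by (rule eventually_ge_at_top)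
  ultimately show ?thesis
  proof (eventually_elim, intro allI impI)
    fix t a s s' :: real and n :: nat
    assume E: "E < t powr (1/4 - \<epsilon>)" and t: "1 \<le> t"
      and s: "\<bar>s - real n / r\<bar> \<le> N * real (Suc n) powr (3/4)"
      and s': "\<bar>s' - real (Suc n) / r\<bar> \<le> N * real (Suc (Suc n)) powr (3/4)"
      and a: "\<bar>a - real n * v / r\<bar> \<le> N * real (Suc n) powr (3/4)"
      and "s \<le> t" "t < s'"
    define p where "p = real (Suc n) powr (3/4)"
    have p1: "1 \<le> p" unfolding p_def by (rule ge_one_powr_ge_zero) auto
    have "real (Suc (Suc n)) powr (3/4) \<le> (2 * real (Suc n)) powr (3/4)"
      by (intro powr_mono2) auto
    also have "\<dots> = 2 powr (3/4) * p" by (simp add: p_def powr_mult del: of_nat_Suc)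
    also have "\<dots> \<le> 2 powr 1 * p" using p1 by (intro mult_right_mono powr_mono) auto
    finally have p2: "real (Suc (Suc n)) powr (3/4) \<le> 2 * p" by simp
    then have "N * real (Suc (Suc n)) powr (3/4) \<le> N * (2 * p)" using N by (rule mult_left_mono)
    moreover have "real (Suc n) / r = real n / r + 1 / r" by (simp add: add_divide_distrib)
    ultimately have upper: "t - real n / r \<le> N * (2 * p) + 1 / r"
      using s' \<open>t < s'\<close> by linarith
    have "0 \<le> N * p" using N p1 by simp
    moreover have "0 \<le> 1 / r" "1 / r \<le> 1 / r * p"
      using r p1 mult_left_mono[of 1 p "1 / r"] by auto
    ultimately have "\<bar>t - real n / r\<bar> \<le> (2 * N + 1 / r) * p"
      using upper s \<open>s \<le> t\<close> unfolding p_def[symmetric] abs_le_iff distrib_right by linarith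
    then have "\<bar>v\<bar> * \<bar>t - real n / r\<bar> \<le> \<bar>v\<bar> * ((2 * N + 1 / r) * p)"
      by (rule mult_left_mono) simp
    moreover have "\<bar>a - v * t\<bar> \<le> \<bar>a - real n * v / r\<bar> + \<bar>v\<bar> * \<bar>t - real n / r\<bar>"
    proof -
      have "a - v * t = (a - real n * v / r) - v * (t - real n / r)" by (simp add: algebra_simps)
      then show ?thesis by (simp only: abs_mult[symmetric] abs_triangle_ineq4)
    qed
    ultimately have "\<bar>a - v * t\<bar> \<le> (N + \<bar>v\<bar> * (2 * N + 1 / r)) * p"
      using a unfolding p_def[symmetric] by (simp add: algebra_simps)
    also have "\<dots> \<le> (N + \<bar>v\<bar> * (2 * N + 1 / r)) * (D powr (3/4) * t powr (3/4))"
    proof (rule mult_left_mono)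
      have "p \<le> (D * t) powr (3/4)"
        unfolding p_def using lin[OF t s \<open>s \<le> t\<close>] by (intro powr_mono2) auto
      then show "p \<le> D powr (3/4) * t powr (3/4)" using D t by (simp add: powr_mult)
    qed (use N r in simp)
    also have "\<dots> = E * t powr (3/4)" by (simp add: E_def)
    also have "\<dots> < t powr (1/4 - \<epsilon>) * t powr (3/4)"
      using E t by (intro mult_strict_right_mono) auto
    also have "\<dots> = t powr (- \<epsilon>) * t"
      using t by (simp add: powr_add[symmetric] powr_mult_base mult.commute)
    finally have "\<bar>a - v * t\<bar> / t < t powr (- \<epsilon>)"
      using t by (simp add: pos_divide_less_eq)
    also have "\<bar>a - v * t\<bar> / t = \<bar>(a - v * t) / t\<bar>" using t by simp
    also have "(a - v * t) / t = a / t - v" using t by (simp add: diff_divide_distrib)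
    finally show "\<bar>a / t - v\<bar> < t powr (- \<epsilon>)" .
  qed
qed

section \<open>Almost sure drift rates of the JLW walk\<close>

context jlw_network begin

lemma ctmc_jump_chain:
  fixes M :: "'w measure"
  assumes "ctmc M rate x0 \<xi>"
  obtains Y H where "uniform_jump_chain M Y H kernel total_rate x0"
    and "AE \<omega> in M. \<forall>n t. (\<Sum>m<n. H m \<omega>) \<le> t \<and> t < (\<Sum>m<Suc n. H m \<omega>) \<longrightarrow> \<xi> t \<omega> = Y n \<omega>"
proof -
  from assms obtain Y :: "nat \<Rightarrow> 'w \<Rightarrow> int ^ 'n" and H where M: "prob_space M"
    and Y: "\<forall>n. Y n \<in> measurable M (count_space UNIV)" and H: "\<forall>n. H n \<in> borel_measurable M"
    and j: "\<forall>n y s. (\<forall>m<n. 0 \<le> s m) \<longrightarrow>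
           measure M {\<omega> \<in> space M. (\<forall>m\<le>n. Y m \<omega> = y m) \<and> (\<forall>m<n. s m < H m \<omega>)} =
             (if y 0 = x0 then 1 else 0) *
             (\<Prod>m<n. jump_prob rate (y m) (y (Suc m)) * exp (- exit_rate rate (y m) * s m))"
    and X: "AE \<omega> in M. \<forall>n t. (\<Sum>m<n. H m \<omega>) \<le> t \<and> t < (\<Sum>m\<le>n. H m \<omega>) \<longrightarrow> \<xi> t \<omega> = Y n \<omega>"
    unfolding ctmc_def by blast
  interpret prob_space M by fact
  have "uniform_jump_chain M Y H kernel total_rate x0"
    using Y H j total_rate_pos
    by unfold_locales (simp_all add: pmf_kernel exit_rate_eq)
  with X show ?thesis
    by (intro that[of Y H]) (simp_all only: lessThan_Suc_atMost)
qed

end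

locale jlw_jump_chain =
  jlw_network A S lam mu w + uniform_jump_chain M Y H "jlw_network.kernel A S lam mu w"
    "jlw_network.total_rate A lam mu" x0
  for A :: "'i set" and S :: "'i \<Rightarrow> 'n::finite set" and lam mu w and M :: "'w measure"
    and Y H x0
begin

abbreviation jump_time :: "nat \<Rightarrow> 'w \<Rightarrow> real" where
  "jump_time n \<omega> \<equiv> \<Sum>m<n. H m \<omega>"

lemma deviation_mean_linear:
  assumes eq: "greedy (V \<pi>) \<pi>"
  shows "(\<integral>\<^sup>+\<omega>. ennreal (deviation \<pi> n (Y n \<omega>)) \<partial>M)
    \<le> ennreal (deviation \<pi> 0 x0 + real n * (\<Sum>j\<in>UNIV. w j))"
proof (induction n)
  case 0
  have "(\<integral>\<^sup>+\<omega>. ennreal (deviation \<pi> 0 (Y 0 \<omega>)) \<partial>M) = (\<integral>\<^sup>+\<omega>. ennreal (deviation \<pi> 0 x0) \<partial>M)"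
    by (rule nn_integral_cong_AE) (use chain_starts_at_x0 in \<open>auto elim!: eventually_mono\<close>)
  then show ?case by (simp add: emeasure_space_1)
next
  case (Suc n)
  have W: "0 \<le> (\<Sum>j\<in>UNIV. w j)" using w_pos by (intro sum_nonneg) (auto intro: less_imp_le)
  have dev0: "0 \<le> deviation \<pi> 0 x0"
    unfolding deviation_def using w_pos by (intro sum_nonneg) (simp add: less_imp_le)
  have "(\<integral>\<^sup>+\<omega>. ennreal (deviation \<pi> (Suc n) (Y (Suc n) \<omega>)) \<partial>M) =
      (\<integral>\<^sup>+\<omega>. (\<integral>\<^sup>+y. ennreal (deviation \<pi> (Suc n) y) \<partial>kernel (Y n \<omega>)) \<partial>M)"
    by (rule nn_integral_jump)
  also have "\<dots> \<le> (\<integral>\<^sup>+\<omega>. ennreal (deviation \<pi> n (Y n \<omega>)) + ennreal (\<Sum>j\<in>UNIV. w j) \<partial>M)"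
    by (intro nn_integral_mono deviation_step eq)
  also have "\<dots> = (\<integral>\<^sup>+\<omega>. ennreal (deviation \<pi> n (Y n \<omega>)) \<partial>M) + ennreal (\<Sum>j\<in>UNIV. w j)"
    by (subst nn_integral_add) (auto simp: emeasure_space_1)
  also have "\<dots> \<le> ennreal (deviation \<pi> 0 x0 + real n * (\<Sum>j\<in>UNIV. w j)) + ennreal (\<Sum>j\<in>UNIV. w j)"
    by (intro add_right_mono Suc.IH)
  also have "\<dots> = ennreal (deviation \<pi> 0 x0 + real (Suc n) * (\<Sum>j\<in>UNIV. w j))"
    using W dev0 by (subst ennreal_plus[symmetric]) (auto simp: algebra_simps)
  finally show ?case .
qed

text \<open>
  The deviation dominates the squared fluctuation of each single queue, and a jump changes a queue
  by at most one, so the two general rate lemmas apply.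
\<close>
lemma weighted_queue_fluctuation:
  assumes eq: "greedy (V \<pi>) \<pi>"
  shows "AE \<omega> in M. \<exists>C. \<forall>n. \<bar>w j * real_of_int (Y n \<omega> $ j) - real n * V \<pi> j / total_rate\<bar>
    \<le> C * real (Suc n) powr (3/4)"
proof -
  define Z where "Z n \<omega> = w j * real_of_int (Y n \<omega> $ j) - real n * V \<pi> j / total_rate" for n \<omega>
  define d where "d = deviation \<pi> 0 x0"
  define W where "W = (\<Sum>j\<in>UNIV. w j)"
  have W: "0 \<le> W" unfolding W_def using w_pos by (intro sum_nonneg) (auto intro: less_imp_le)
  have d: "0 \<le> d"
    unfolding d_def deviation_def using w_pos by (intro sum_nonneg) (simp add: less_imp_le)
  have Z_meas [measurable]: "Z n \<in> borel_measurable M" for n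
  proof -
    have "(\<lambda>\<omega>. (\<lambda>y. w j * real_of_int (y $ j) - real n * V \<pi> j / total_rate) (Y n \<omega>)) \<in> borel_measurable M"
      by measurable
    then show ?thesis by (simp add: Z_def[abs_def])
  qed
  have "(\<integral>\<^sup>+\<omega>. ennreal ((Z n \<omega>)\<^sup>2) \<partial>M) \<le> ennreal (w j * (d + W) * real (Suc n))" for n
  proof -
    have "(Z n \<omega>)\<^sup>2 \<le> w j * deviation \<pi> n (Y n \<omega>)" for \<omega>
    proof -
      let ?z = "\<lambda>k. real_of_int (Y n \<omega> $ k) - real n * drift A lam mu \<pi> k / total_rate"
      have "w j * (?z j)\<^sup>2 \<le> deviation \<pi> n (Y n \<omega>)"
        unfolding deviation_def using w_pos
        by (intro member_le_sum[where f = "\<lambda>k. w k * (?z k)\<^sup>2"]) (simp_all add: less_imp_le)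
      then have "w j * (w j * (?z j)\<^sup>2) \<le> w j * deviation \<pi> n (Y n \<omega>)"
        using w_pos[of j] by (intro mult_left_mono) auto
      moreover have "Z n \<omega> = w j * ?z j" by (simp add: Z_def algebra_simps)
      ultimately show ?thesis by (simp add: power_mult_distrib power2_eq_square mult_ac)
    qed
    then have "(\<integral>\<^sup>+\<omega>. ennreal ((Z n \<omega>)\<^sup>2) \<partial>M) \<le>
        (\<integral>\<^sup>+\<omega>. ennreal (w j) * ennreal (deviation \<pi> n (Y n \<omega>)) \<partial>M)"
      using w_pos[of j] by (intro nn_integral_mono) (simp add: ennreal_leI flip: ennreal_mult')
    also have "\<dots> = ennreal (w j) * (\<integral>\<^sup>+\<omega>. ennreal (deviation \<pi> n (Y n \<omega>)) \<partial>M)"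
      by (rule nn_integral_cmult) measurable
    also have "\<dots> \<le> ennreal (w j) * ennreal (d + real n * W)"
      unfolding d_def W_def by (intro mult_left_mono deviation_mean_linear[OF eq]) simp
    also have "\<dots> = ennreal (w j * (d + real n * W))"
      using w_pos[of j] by (simp add: ennreal_mult')
    also have "\<dots> \<le> ennreal (w j * (d + W) * real (Suc n))"
    proof (rule ennreal_leI)
      have "d + real n * W \<le> (d + W) * real (Suc n)"
        using W d by (simp add: algebra_simps)
      then show "w j * (d + real n * W) \<le> w j * (d + W) * real (Suc n)"
        using w_pos[of j] by (simp only: mult.assoc) (intro mult_left_mono, auto)
    qed
    finally show ?thesis .
  qed
  then have "AE \<omega> in M. \<exists>B. \<forall>m. \<bar>Z (m ^ 4) \<omega>\<bar> \<le> B * real (Suc m) ^ 3"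
    using W d w_pos[of j] by (intro quartic_subsequence_bound[where c = "w j * (d + W)"]) auto
  then show ?thesis
    using jumps_in_support
  proof eventually_elim
    fix \<omega> assume "\<exists>B. \<forall>m. \<bar>Z (m ^ 4) \<omega>\<bar> \<le> B * real (Suc m) ^ 3"
      and jumps: "\<forall>n. Y (Suc n) \<omega> \<in> set_pmf (kernel (Y n \<omega>))"
    then obtain B where B: "\<And>m. \<bar>Z (m ^ 4) \<omega>\<bar> \<le> B * real (Suc m) ^ 3" by blast
    have "Z n \<omega> - (w j + \<bar>V \<pi> j / total_rate\<bar>) \<le> Z (Suc n) \<omega>" for n
    proof -
      have "\<bar>Y (Suc n) \<omega> $ j - Y n \<omega> $ j\<bar> \<le> 1"
        using jumps set_pmf_kernel neighbours_coordinate by blast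
      then have "Y n \<omega> $ j \<le> Y (Suc n) \<omega> $ j + 1" by linarith
      then have "real_of_int (Y n \<omega> $ j) \<le> real_of_int (Y (Suc n) \<omega> $ j) + 1" by linarith
      then have "w j * real_of_int (Y n \<omega> $ j) \<le> w j * (real_of_int (Y (Suc n) \<omega> $ j) + 1)"
        using w_pos[of j] by (intro mult_left_mono) auto
      moreover have "V \<pi> j / total_rate \<le> \<bar>V \<pi> j / total_rate\<bar>" by (rule abs_ge_self)
      moreover have "real (Suc n) * V \<pi> j / total_rate =
          real n * V \<pi> j / total_rate + V \<pi> j / total_rate"
        by (simp add: add_divide_distrib distrib_right)
      ultimately show ?thesis
        unfolding Z_def distrib_left by linarith
    qed
    from one_sided_increments_interpolate[of "\<lambda>n. Z n \<omega>", OF this _ B]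
    show "\<exists>C. \<forall>n. \<bar>w j * real_of_int (Y n \<omega> $ j) - real n * V \<pi> j / total_rate\<bar>
        \<le> C * real (Suc n) powr (3/4)"
      using w_pos[of j] by (simp add: Z_def)
  qed
qed

lemma jump_time_fluctuation:
  "AE \<omega> in M. \<exists>C. \<forall>n. \<bar>jump_time n \<omega> - real n / total_rate\<bar> \<le> C * real (Suc n) powr (3/4)"
proof -
  have "AE \<omega> in M. \<exists>B. \<forall>m. \<bar>jump_time (m ^ 4) \<omega> - real (m ^ 4) / total_rate\<bar> \<le> B * real (Suc m) ^ 3"
  proof (rule quartic_subsequence_bound[where c = "1 / total_rate\<^sup>2"])
    show "(\<integral>\<^sup>+\<omega>. ennreal ((jump_time n \<omega> - real n / total_rate)\<^sup>2) \<partial>M)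
        \<le> ennreal (1 / total_rate\<^sup>2 * real (Suc n))" for n
      unfolding jump_time_variance by (intro ennreal_leI) (simp add: divide_right_mono)
  qed auto
  then show ?thesis
    using holding_positive
  proof eventually_elim
    fix \<omega> assume "\<exists>B. \<forall>m. \<bar>jump_time (m ^ 4) \<omega> - real (m ^ 4) / total_rate\<bar> \<le> B * real (Suc m) ^ 3"
      and pos: "\<forall>m. 0 < H m \<omega>"
    then obtain B where
      B: "\<And>m. \<bar>jump_time (m ^ 4) \<omega> - real (m ^ 4) / total_rate\<bar> \<le> B * real (Suc m) ^ 3" by blast
    have "(jump_time n \<omega> - real n / total_rate) - 1 / total_rate
        \<le> jump_time (Suc n) \<omega> - real (Suc n) / total_rate" for n
      using pos[rule_format, of n] by (simp add: add_divide_distrib)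
    from one_sided_increments_interpolate[of "\<lambda>n. jump_time n \<omega> - real n / total_rate", OF this _ B]
    show "\<exists>C. \<forall>n. \<bar>jump_time n \<omega> - real n / total_rate\<bar> \<le> C * real (Suc n) powr (3/4)"
      using total_rate_pos by simp
  qed
qed

text \<open>
  Events on which both fluctuation bounds hold with the constant \<open>N\<close>. They are measurable and
  exhaust the space up to a null set, and on each of them the threshold time can be chosen
  deterministically.
\<close>
definition tame :: "('i \<Rightarrow> 'n \<Rightarrow> real) \<Rightarrow> nat \<Rightarrow> 'w set" where
  "tame \<pi> N = {\<omega>\<in>space M. \<forall>n.
     \<bar>jump_time n \<omega> - real n / total_rate\<bar> \<le> real N * real (Suc n) powr (3/4) \<and>
     (\<forall>j. \<bar>w j * real_of_int (Y n \<omega> $ j) - real n * V \<pi> j / total_rate\<bar>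
        \<le> real N * real (Suc n) powr (3/4))}"

lemma tame_measurable [measurable]: "tame \<pi> N \<in> sets M"
proof -
  have [measurable]: "(\<lambda>\<omega>. real_of_int (Y n \<omega> $ j)) \<in> borel_measurable M" for n j
  proof -
    have "(\<lambda>\<omega>. (\<lambda>y. real_of_int (y $ j)) (Y n \<omega>)) \<in> borel_measurable M" by measurable
    then show ?thesis by simp
  qed
  show ?thesis unfolding tame_def by measurable
qed

lemma almost_surely_tame:
  assumes "greedy (V \<pi>) \<pi>"
  shows "AE \<omega> in M. \<exists>N. \<omega> \<in> tame \<pi> N"
proof -
  have "AE \<omega> in M. \<forall>j. \<exists>C. \<forall>n. \<bar>w j * real_of_int (Y n \<omega> $ j) - real n * V \<pi> j / total_rate\<bar>
      \<le> C * real (Suc n) powr (3/4)"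
    using weighted_queue_fluctuation[OF assms] by (intro eventually_all_finite) 
  with jump_time_fluctuation AE_space show ?thesis
  proof eventually_elim
    fix \<omega> assume \<omega>: "\<omega> \<in> space M"
      and "\<exists>C. \<forall>n. \<bar>jump_time n \<omega> - real n / total_rate\<bar> \<le> C * real (Suc n) powr (3/4)"
      and "\<forall>j. \<exists>C. \<forall>n. \<bar>w j * real_of_int (Y n \<omega> $ j) - real n * V \<pi> j / total_rate\<bar>
        \<le> C * real (Suc n) powr (3/4)"
    then obtain C0 C where
      C0: "\<And>n. \<bar>jump_time n \<omega> - real n / total_rate\<bar> \<le> C0 * real (Suc n) powr (3/4)"
      and C: "\<And>j n. \<bar>w j * real_of_int (Y n \<omega> $ j) - real n * V \<pi> j / total_rate\<bar>
        \<le> C j * real (Suc n) powr (3/4)"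
      by metis
    obtain N :: nat where N: "max C0 (MAX j. C j) \<le> real N" by (rule real_arch_simple[THEN exE])
    have "C j \<le> (MAX j. C j)" for j by (intro Max_ge) auto
    then have "C0 \<le> real N" "C j \<le> real N" for j using N by (auto intro: order_trans)
    then have "\<omega> \<in> tame \<pi> N"
      unfolding tame_def using \<omega> by (auto intro!: order_trans[OF C0] order_trans[OF C] mult_right_mono)
    then show "\<exists>N. \<omega> \<in> tame \<pi> N" ..
  qed
qed

lemma tame_jump_times_cover:
  assumes \<omega>: "\<omega> \<in> tame \<pi> N" and t: "1 \<le> t"
  shows "\<exists>n. jump_time n \<omega> \<le> t \<and> t < jump_time (Suc n) \<omega>"
proof -
  obtain D where lin: "\<And>n. jump_time n \<omega> \<le> t \<Longrightarrow> real (Suc n) \<le> D * t"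
    using jump_count_linear[OF total_rate_pos, of "real N"] \<omega> t unfolding tame_def by fastforce
  obtain n where "D * t < real n" using reals_Archimedean2 by blast
  then have "t < jump_time n \<omega>" using lin[of n] by force
  from ex_least_nat_less[of "\<lambda>n. t < jump_time n \<omega>", OF this]
  obtain k where "\<forall>i\<le>k. \<not> t < jump_time i \<omega>" "t < jump_time (Suc k) \<omega>" using t by auto
  then show ?thesis by (intro exI[of _ k]) (auto simp: not_less)
qed

end

context jlw_network begin

lemma tame_threshold:
  assumes \<epsilon>: "\<epsilon> < 1/4"
  obtains t0 :: "nat \<Rightarrow> real" where "\<And>N. 1 \<le> t0 N" and
    "\<And>N t j n a s s'. t0 N < t \<Longrightarrow>
      \<bar>s - real n / total_rate\<bar> \<le> real N * real (Suc n) powr (3/4) \<Longrightarrow>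
      \<bar>s' - real (Suc n) / total_rate\<bar> \<le> real N * real (Suc (Suc n)) powr (3/4) \<Longrightarrow>
      \<bar>a - real n * V \<pi> j / total_rate\<bar> \<le> real N * real (Suc n) powr (3/4) \<Longrightarrow>
      s \<le> t \<Longrightarrow> t < s' \<Longrightarrow> \<bar>a / t - V \<pi> j\<bar> < t powr (- \<epsilon>)"
proof -
  have "\<forall>\<^sub>F t in at_top. \<forall>j. \<forall>n a s s'.
    \<bar>s - real n / total_rate\<bar> \<le> real N * real (Suc n) powr (3/4) \<longrightarrow>
    \<bar>s' - real (Suc n) / total_rate\<bar> \<le> real N * real (Suc (Suc n)) powr (3/4) \<longrightarrow>
    \<bar>a - real n * V \<pi> j / total_rate\<bar> \<le> real N * real (Suc n) powr (3/4) \<longrightarrow>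
    s \<le> t \<longrightarrow> t < s' \<longrightarrow> \<bar>a / t - V \<pi> j\<bar> < t powr (- \<epsilon>)" for N
    by (intro eventually_all_finite time_change_rate total_rate_pos \<epsilon>) simp
  then have "\<forall>N. \<exists>b. \<forall>t>b. \<forall>j. \<forall>n a s s'.
    \<bar>s - real n / total_rate\<bar> \<le> real N * real (Suc n) powr (3/4) \<longrightarrow>
    \<bar>s' - real (Suc n) / total_rate\<bar> \<le> real N * real (Suc (Suc n)) powr (3/4) \<longrightarrow>
    \<bar>a - real n * V \<pi> j / total_rate\<bar> \<le> real N * real (Suc n) powr (3/4) \<longrightarrow>
    s \<le> t \<longrightarrow> t < s' \<longrightarrow> \<bar>a / t - V \<pi> j\<bar> < t powr (- \<epsilon>)"
    unfolding eventually_at_top_dense by blast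
  from choice[OF this] obtain b where b: "\<forall>N. \<forall>t>b N. \<forall>j. \<forall>n a s s'.
    \<bar>s - real n / total_rate\<bar> \<le> real N * real (Suc n) powr (3/4) \<longrightarrow>
    \<bar>s' - real (Suc n) / total_rate\<bar> \<le> real N * real (Suc (Suc n)) powr (3/4) \<longrightarrow>
    \<bar>a - real n * V \<pi> j / total_rate\<bar> \<le> real N * real (Suc n) powr (3/4) \<longrightarrow>
    s \<le> t \<longrightarrow> t < s' \<longrightarrow> \<bar>a / t - V \<pi> j\<bar> < t powr (- \<epsilon>)" ..
  show ?thesis
    by (rule that[of "\<lambda>N. max 1 (b N)"]) (use b in auto)
qed

lemma jlw_rates_from_equilibrium:
  fixes M :: "'w measure"
  assumes eq: "greedy (V \<pi>) \<pi>" and \<epsilon>: "\<epsilon> < 1/4" and ctmc: "ctmc M rate x0 \<xi>"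
  shows "\<exists>\<tau> :: 'w \<Rightarrow> ennreal. \<tau> \<in> borel_measurable M \<and> (AE \<omega> in M. \<tau> \<omega> < \<infinity>) \<and>
    (AE \<omega> in M. \<forall>t. \<tau> \<omega> < ennreal t \<longrightarrow>
      (\<forall>j. \<bar>w j * real_of_int (\<xi> t \<omega> $ j) / t - V \<pi> j\<bar> < t powr (- \<epsilon>)))"
proof -
  obtain Y H where chain: "uniform_jump_chain M Y H kernel total_rate x0" and
    X: "AE \<omega> in M. \<forall>n t. (\<Sum>m<n. H m \<omega>) \<le> t \<and> t < (\<Sum>m<Suc n. H m \<omega>) \<longrightarrow> \<xi> t \<omega> = Y n \<omega>"
    using ctmc_jump_chain[OF ctmc] by blast
  interpret jlw_jump_chain A S lam mu w M Y H x0
    using chain by (simp add: jlw_jump_chain_def jlw_network_axioms)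
  obtain t0 where t0: "\<And>N. 1 \<le> t0 N" and
    rate: "\<And>N t j n a s s'. t0 N < t \<Longrightarrow>
      \<bar>s - real n / total_rate\<bar> \<le> real N * real (Suc n) powr (3/4) \<Longrightarrow>
      \<bar>s' - real (Suc n) / total_rate\<bar> \<le> real N * real (Suc (Suc n)) powr (3/4) \<Longrightarrow>
      \<bar>a - real n * V \<pi> j / total_rate\<bar> \<le> real N * real (Suc n) powr (3/4) \<Longrightarrow>
      s \<le> t \<Longrightarrow> t < s' \<Longrightarrow> \<bar>a / t - V \<pi> j\<bar> < t powr (- \<epsilon>)"
    by (rule tame_threshold[OF \<epsilon>, of \<pi>]) blast
  \<comment> \<open>An infimum over the tame events keeps the random time measurable, while \<open>\<tau> \<omega> < t\<close> still yields a single \<open>N\<close>.\<close>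
  define \<tau> where "\<tau> \<omega> = (INF N. if \<omega> \<in> tame \<pi> N then ennreal (t0 N) else \<infinity>)" for \<omega>
  have "\<tau> \<in> borel_measurable M"
    unfolding \<tau>_def[abs_def] by measurable
  moreover have "AE \<omega> in M. \<tau> \<omega> < \<infinity>"
    using almost_surely_tame[OF eq]
  proof eventually_elim
    fix \<omega> assume "\<exists>N. \<omega> \<in> tame \<pi> N"
    then obtain N where "(if \<omega> \<in> tame \<pi> N then ennreal (t0 N) else \<infinity>) < \<infinity>" by auto
    then show "\<tau> \<omega> < \<infinity>" unfolding \<tau>_def INF_less_iff by blast
  qed
  moreover have "AE \<omega> in M. \<forall>t. \<tau> \<omega> < ennreal t \<longrightarrow>
      (\<forall>j. \<bar>w j * real_of_int (\<xi> t \<omega> $ j) / t - V \<pi> j\<bar> < t powr (- \<epsilon>))"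
    using X
  proof (eventually_elim, intro allI impI)
    fix \<omega> t j
    assume X: "\<forall>n t. jump_time n \<omega> \<le> t \<and> t < jump_time (Suc n) \<omega> \<longrightarrow> \<xi> t \<omega> = Y n \<omega>"
      and "\<tau> \<omega> < ennreal t"
    then obtain N where "(if \<omega> \<in> tame \<pi> N then ennreal (t0 N) else \<infinity>) < ennreal t"
      unfolding \<tau>_def INF_less_iff by blast
    then have N: "\<omega> \<in> tame \<pi> N" "ennreal (t0 N) < ennreal t"
      by (auto split: if_splits)
    then have t: "t0 N < t" using t0[of N] by (simp add: ennreal_less_iff)
    then obtain n where n: "jump_time n \<omega> \<le> t" "t < jump_time (Suc n) \<omega>"
      using tame_jump_times_cover[OF N(1), of t] t0[of N] by auto
    then have "\<xi> t \<omega> = Y n \<omega>" using X by blast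
    moreover have "\<bar>jump_time m \<omega> - real m / total_rate\<bar> \<le> real N * real (Suc m) powr (3/4)"
      and "\<bar>w j * real_of_int (Y m \<omega> $ j) - real m * V \<pi> j / total_rate\<bar>
        \<le> real N * real (Suc m) powr (3/4)" for m
      using N(1) unfolding tame_def by blast+
    ultimately show "\<bar>w j * real_of_int (\<xi> t \<omega> $ j) / t - V \<pi> j\<bar> < t powr (- \<epsilon>)"
      by (simp only:) (rule rate[OF t _ _ _ n])
  qed
  ultimately show ?thesis by blast
qed

end

theorem theorem4:
  fixes I :: "'i set"
    and S :: "'i \<Rightarrow> 'n::finite set"
    and lam :: "'i \<Rightarrow> real"
    and mu w :: "'n \<Rightarrow> real"
    and A :: "'i set"
  assumes "finite I"
    and "\<And>i. i \<in> I \<Longrightarrow> S i \<noteq> {}"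
    and "\<And>i. i \<in> I \<Longrightarrow> lam i \<ge> 0"
    and "\<And>j. mu j > 0"
    and "\<And>j. w j > 0"
    and "A = active_nbhds I lam"
    and "connected_network A S"
  shows "\<exists>\<epsilon>0>0. \<forall>\<epsilon> x0 (M :: 'w measure) \<xi>.
      0 < \<epsilon> \<and> \<epsilon> < \<epsilon>0 \<and> ctmc M (jlw_rate A S lam mu w) x0 \<xi> \<longrightarrow>
      (\<exists>\<tau> :: 'w \<Rightarrow> ennreal. \<tau> \<in> borel_measurable M \<and> (AE \<omega> in M. \<tau> \<omega> < \<infinity>) \<and>
        (AE \<omega> in M. \<forall>t. \<tau> \<omega> < ennreal t \<longrightarrow>
          (\<forall>k\<in>{1..hmd_length A S lam mu w}. \<forall>j\<in>hmd_cluster A S lam mu w k.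
            \<bar>w j * real_of_int (\<xi> t \<omega> $ j) / t - hmd_rate A S lam mu w k\<bar> < t powr (- \<epsilon>))))"
proof -
  interpret jlw_network A S lam mu w
    using assms(1-6) by unfold_locales (auto simp: active_nbhds_def)
  obtain \<pi> where \<pi>: "greedy (V \<pi>) \<pi>" using exists_equilibrium by blast
  have rates: "hmd_rate A S lam mu w k = V \<pi> j"
    if "k \<in> {1..hmd_length A S lam mu w}" "j \<in> hmd_cluster A S lam mu w k" for k j
    using hmd_cluster_equilibrium[OF \<pi> that] .
  show ?thesis
  proof (intro exI[of _ "1/4"] conjI allI impI)
    fix \<epsilon> :: real and x0 and M :: "'w measure" and \<xi>
    assume "0 < \<epsilon> \<and> \<epsilon> < 1/4 \<and> ctmc M (jlw_rate A S lam mu w) x0 \<xi>"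
    then obtain \<tau> :: "'w \<Rightarrow> ennreal" where \<tau>: "\<tau> \<in> borel_measurable M" "AE \<omega> in M. \<tau> \<omega> < \<infinity>"
      "AE \<omega> in M. \<forall>t. \<tau> \<omega> < ennreal t \<longrightarrow>
        (\<forall>j. \<bar>w j * real_of_int (\<xi> t \<omega> $ j) / t - V \<pi> j\<bar> < t powr (- \<epsilon>))"
      using jlw_rates_from_equilibrium[OF \<pi>] by blast
    from \<tau>(3) have "AE \<omega> in M. \<forall>t. \<tau> \<omega> < ennreal t \<longrightarrow>
        (\<forall>k\<in>{1..hmd_length A S lam mu w}. \<forall>j\<in>hmd_cluster A S lam mu w k.
          \<bar>w j * real_of_int (\<xi> t \<omega> $ j) / t - hmd_rate A S lam mu w k\<bar> < t powr (- \<epsilon>))"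
      by (rule eventually_mono) (metis rates)
    with \<tau>(1,2) show "\<exists>\<tau> :: 'w \<Rightarrow> ennreal. \<tau> \<in> borel_measurable M \<and> (AE \<omega> in M. \<tau> \<omega> < \<infinity>) \<and>
        (AE \<omega> in M. \<forall>t. \<tau> \<omega> < ennreal t \<longrightarrow>
          (\<forall>k\<in>{1..hmd_length A S lam mu w}. \<forall>j\<in>hmd_cluster A S lam mu w k.
            \<bar>w j * real_of_int (\<xi> t \<omega> $ j) / t - hmd_rate A S lam mu w k\<bar> < t powr (- \<epsilon>)))"
      by blast
  qed simp
qed

end
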